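(* Let $\mathbb{L}$ be a Dedekind-complete unital $f$-algebra over $\mathbb{R}$. Let $X$ be a directed partially ordered $\mathbb{L}$-module with the Riesz Decomposition Property, and let $Y$ be a Dedekind-complete $\mathbb{L}$-vector lattice. Suppose that $Y$ is sequentially $\mathbb{P}$-Archimedean or that $\mathbb{L}=\mathbb{L}_1$. Then the following hold. 1. $\mathcal{L}_{\mathrm{b}}(X,Y)$ is an $\mathbb{L}$-vector lattice. 2. $\mathcal{L}_{\mathrm{b}}(X,Y)=\mathcal{L}_{\mathrm{r}}(X,Y)$. 3. $\mathcal{L}_{\mathrm{b}}(X,Y)$ is Dedekind-complete. 4. The lattice operations in $\mathcal{L}_{\mathrm{b}}(X,Y)$ are given by the following formulas: for all $S,T\in\mathcal{L}_{\mathrm{b}}(X,Y)$ and all $x\in X^+$, $$(S\vee T)(x)=\sup\{S(y)+T(x-y): y\in[0,x]\},$$ $$(S\wedge T)(x)=\inf\{S(y)+T(x-y): y\in[0,x]\},$$ $$S^+(x)=\sup\{S(y): y\in[0,x]\},$$ $$S^-(x)=-\inf\{S(y): y\in[0,x]\},$$ $$|S|(x)=\sup\{S(y): y\in[-x,x]\}.$$ 5. For every increasing net $(T_\alpha)$ in $\mathcal{L}_{\mathrm{b}}(X,Y)$ and every $T\in\mathcal{L}_{\mathrm{b}}(X,Y)$, we have $T_\alpha\uparrow T$ in $\mathcal{L}_{\mathrm{b}}(X,Y)$ if and only if $T_\alpha(x)\uparrow T(x)$ in $Y$ for all $x\in X^+$.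
   Context: $\mathbb{L}$ is a real Dedekind-complete unital $f$-algebra with multiplicative unit $1$; each $r\in\mathbb{R}$ is identified with $r\cdot 1\in\mathbb{L}$. $\mathbb{P}=\{\pi\in\mathbb{L}:\pi^2=\pi\}$ is the set of idempotents of $\mathbb{L}$. $\mathbb{L}_1$ is the vector lattice ideal of $\mathbb{L}$ generated by $1$, i.e. $\{\lambda\in\mathbb{L}: |\lambda|\le r \text{ for some } r\in\mathbb{R}\}$. A partially ordered (PO) $\mathbb{L}$-module is an $\mathbb{L}$-module $X$ with a partial order such that $x\le y$ implies $x+z\le y+z$, and $0\le\lambda$ in $\mathbb{L}$ together with $x\le y$ imply $\lambda x\le\lambda y$. Its positive cone is $X^+=\{x\in X:0\le x\}$. $X$ is directed if every pair of elements of $X$ has an upper bound. $X$ is an $\mathbb{L}$-vector lattice if its partial order is a lattice order; then $x^+=x\vee 0$, $x^-=(-x)\vee 0$, $|x|=x\vee(-x)$. Order intervals are $[x,y]=\{z:x\le z\le y\}$. A PO $\mathbb{L}$-module $X$ has the Riesz Decomposition Property (RDP) if $[0,x+y]=[0,x]+[0,y]$ for all $x,y\in X^+$. A poset is Dedekind-complete if every non-empty subset with an upper bound has a supremum (equivalently, this together with the dual condition on infima). A PO $\mathbb{L}$-module $Y$ is sequentially $\mathbb{P}$-Archimedean if for every decreasing sequence $(\pi_n)$ in $\mathbb{P}$ with infimum $0$ in $\mathbb{L}$ and every $y\in Y^+$, the (decreasing) sequence $(\pi_n y)$ has infimum $0$ in $Y$. For PO $\mathbb{L}$-modules $X,Y$,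 an operator $X\to Y$ is an $\mathbb{L}$-module homomorphism. An operator is positive if it maps $X^+$ into $Y^+$; regular if it is the difference of two positive operators; order-bounded if it maps every order interval of $X$ into an order interval of $Y$. $\mathcal{L}_{\mathrm{r}}(X,Y)$ and $\mathcal{L}_{\mathrm{b}}(X,Y)$ denote the sets of regular and of order-bounded operators, ordered by $S\le T$ iff $T-S$ is positive, with pointwise module operations. For an increasing net, $T_\alpha\uparrow T$ means that $T$ is the supremum of the net. *)

theory Defs
  imports
    Complex_Main
    "HOL-Library.Lattice_Algebras"
    "HOL-Library.Function_Algebras"
    "HOL-Library.Set_Algebras"
begin

text \<open>
  Unital \<open>f\<close>-algebras over the reals. Commutativity is not assumed (for Dedekind-complete algebras it
  is a theorem), and \<^class>\<open>monoid_mult\<close> is used instead of \<^class>\<open>real_algebra_1\<close> so that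
  \<open>0 \<noteq> 1\<close> is not assumed either. A Dedekind-complete unital \<open>f\<close>-algebra is a type of sort
  \<open>{unital_f_algebra, conditionally_complete_lattice}\<close>.
\<close>

class unital_f_algebra = lattice_ring + real_algebra + ordered_real_vector + monoid_mult +
  assumes f_algebra_left: "inf a b = 0 \<Longrightarrow> 0 \<le> c \<Longrightarrow> inf (c * a) b = 0"
    and f_algebra_right: "inf a b = 0 \<Longrightarrow> 0 \<le> c \<Longrightarrow> inf (a * c) b = 0"

definition idempotents :: "'l::unital_f_algebra set" where
  "idempotents = {p. p * p = p}"

definition ideal_of_one :: "'l::unital_f_algebra set" where
  "ideal_of_one = {a. \<exists>r::real. \<bar>a\<bar> \<le> r *\<^sub>R 1}"

text \<open>
  The order on a space of operators is not the pointwise order of the function type, so the order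
  notions take the carrier and the order relation as arguments.
\<close>

definition is_sup :: "'a set \<Rightarrow> ('a \<Rightarrow> 'a \<Rightarrow> bool) \<Rightarrow> 'a set \<Rightarrow> 'a \<Rightarrow> bool" where
  "is_sup M le A s \<longleftrightarrow>
     s \<in> M \<and> (\<forall>a\<in>A. le a s) \<and> (\<forall>u\<in>M. (\<forall>a\<in>A. le a u) \<longrightarrow> le s u)"

definition is_inf :: "'a set \<Rightarrow> ('a \<Rightarrow> 'a \<Rightarrow> bool) \<Rightarrow> 'a set \<Rightarrow> 'a \<Rightarrow> bool" where
  "is_inf M le A s \<longleftrightarrow>
     s \<in> M \<and> (\<forall>a\<in>A. le s a) \<and> (\<forall>u\<in>M. (\<forall>a\<in>A. le u a) \<longrightarrow> le u s)"

definition join_on :: "'a set \<Rightarrow> ('a \<Rightarrow> 'a \<Rightarrow> bool) \<Rightarrow> 'a \<Rightarrow> 'a \<Rightarrow> 'a" where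
  "join_on M le a b = (THE s. is_sup M le {a, b} s)"

definition meet_on :: "'a set \<Rightarrow> ('a \<Rightarrow> 'a \<Rightarrow> bool) \<Rightarrow> 'a \<Rightarrow> 'a \<Rightarrow> 'a" where
  "meet_on M le a b = (THE s. is_inf M le {a, b} s)"

definition dedekind_complete_on :: "'a set \<Rightarrow> ('a \<Rightarrow> 'a \<Rightarrow> bool) \<Rightarrow> bool" where
  "dedekind_complete_on M le \<longleftrightarrow>
     (\<forall>A. A \<subseteq> M \<and> A \<noteq> {} \<and> (\<exists>u\<in>M. \<forall>a\<in>A. le a u) \<longrightarrow> (\<exists>s. is_sup M le A s))"

locale po_module =
  fixes M :: "'m::ab_group_add set"
    and smul :: "'l::unital_f_algebra \<Rightarrow> 'm \<Rightarrow> 'm"  (infixr \<open>\<cdot>\<close> 75)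
    and le :: "'m \<Rightarrow> 'm \<Rightarrow> bool"  (infix \<open>\<preceq>\<close> 50)
  assumes zero_mem: "0 \<in> M"
    and add_mem: "x \<in> M \<Longrightarrow> y \<in> M \<Longrightarrow> x + y \<in> M"
    and uminus_mem: "x \<in> M \<Longrightarrow> - x \<in> M"
    and smul_mem: "x \<in> M \<Longrightarrow> a \<cdot> x \<in> M"
    and smul_add_right: "x \<in> M \<Longrightarrow> y \<in> M \<Longrightarrow> a \<cdot> (x + y) = a \<cdot> x + a \<cdot> y"
    and smul_add_left: "x \<in> M \<Longrightarrow> (a + b) \<cdot> x = a \<cdot> x + b \<cdot> x"
    and smul_smul: "x \<in> M \<Longrightarrow> a \<cdot> (b \<cdot> x) = (a * b) \<cdot> x"
    and smul_one: "x \<in> M \<Longrightarrow> 1 \<cdot> x = x"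
    and le_refl: "x \<in> M \<Longrightarrow> x \<preceq> x"
    and le_antisym: "x \<in> M \<Longrightarrow> y \<in> M \<Longrightarrow> x \<preceq> y \<Longrightarrow> y \<preceq> x \<Longrightarrow> x = y"
    and le_trans: "x \<in> M \<Longrightarrow> y \<in> M \<Longrightarrow> z \<in> M \<Longrightarrow> x \<preceq> y \<Longrightarrow> y \<preceq> z \<Longrightarrow> x \<preceq> z"
    and le_add: "x \<in> M \<Longrightarrow> y \<in> M \<Longrightarrow> z \<in> M \<Longrightarrow> x \<preceq> y \<Longrightarrow> x + z \<preceq> y + z"
    and le_smul: "x \<in> M \<Longrightarrow> y \<in> M \<Longrightarrow> 0 \<le> a \<Longrightarrow> x \<preceq> y \<Longrightarrow> a \<cdot> x \<preceq> a \<cdot> y"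

locale vector_lattice_module = po_module +
  assumes ex_sup: "x \<in> M \<Longrightarrow> y \<in> M \<Longrightarrow> \<exists>s. is_sup M le {x, y} s"
    and ex_inf: "x \<in> M \<Longrightarrow> y \<in> M \<Longrightarrow> \<exists>s. is_inf M le {x, y} s"

definition sequentially_P_archimedean ::
    "('l::unital_f_algebra \<Rightarrow> 'y::ordered_ab_group_add \<Rightarrow> 'y) \<Rightarrow> bool" where
  "sequentially_P_archimedean sY \<longleftrightarrow>
     (\<forall>p::nat \<Rightarrow> 'l. range p \<subseteq> idempotents \<and> decseq p \<and> is_inf UNIV (\<le>) (range p) 0 \<longrightarrow>
       (\<forall>y\<ge>0. is_inf UNIV (\<le>) (range (\<lambda>n. sY (p n) y)) 0))"

definition operator ::
    "('l::unital_f_algebra \<Rightarrow> 'x::ab_group_add \<Rightarrow> 'x) \<Rightarrow> ('l \<Rightarrow> 'y::ab_group_add \<Rightarrow> 'y) \<Rightarrow>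
     ('x \<Rightarrow> 'y) \<Rightarrow> bool" where
  "operator sX sY T \<longleftrightarrow>
     (\<forall>x x'. T (x + x') = T x + T x') \<and> (\<forall>a x. T (sX a x) = sY a (T x))"

definition positive_operator ::
    "('l::unital_f_algebra \<Rightarrow> 'x::ordered_ab_group_add \<Rightarrow> 'x) \<Rightarrow>
     ('l \<Rightarrow> 'y::ordered_ab_group_add \<Rightarrow> 'y) \<Rightarrow> ('x \<Rightarrow> 'y) \<Rightarrow> bool" where
  "positive_operator sX sY T \<longleftrightarrow> operator sX sY T \<and> (\<forall>x\<ge>0. 0 \<le> T x)"

definition regular_operators ::
    "('l::unital_f_algebra \<Rightarrow> 'x::ordered_ab_group_add \<Rightarrow> 'x) \<Rightarrow>
     ('l \<Rightarrow> 'y::ordered_ab_group_add \<Rightarrow> 'y) \<Rightarrow> ('x \<Rightarrow> 'y) set" where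
  "regular_operators sX sY =
     {T. \<exists>U V. positive_operator sX sY U \<and> positive_operator sX sY V \<and> T = U - V}"

definition order_bounded_operators ::
    "('l::unital_f_algebra \<Rightarrow> 'x::ordered_ab_group_add \<Rightarrow> 'x) \<Rightarrow>
     ('l \<Rightarrow> 'y::ordered_ab_group_add \<Rightarrow> 'y) \<Rightarrow> ('x \<Rightarrow> 'y) set" where
  "order_bounded_operators sX sY =
     {T. operator sX sY T \<and> (\<forall>a b. \<exists>c d. T ` {a..b} \<subseteq> {c..d})}"

definition operator_le ::
    "('l::unital_f_algebra \<Rightarrow> 'x::ordered_ab_group_add \<Rightarrow> 'x) \<Rightarrow>
     ('l \<Rightarrow> 'y::ordered_ab_group_add \<Rightarrow> 'y) \<Rightarrow> ('x \<Rightarrow> 'y) \<Rightarrow> ('x \<Rightarrow> 'y) \<Rightarrow> bool" where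
  "operator_le sX sY S T \<longleftrightarrow> positive_operator sX sY (T - S)"

definition operator_smul ::
    "('l \<Rightarrow> 'y \<Rightarrow> 'y) \<Rightarrow> 'l \<Rightarrow> ('x \<Rightarrow> 'y) \<Rightarrow> 'x \<Rightarrow> 'y" where
  "operator_smul sY a T = (\<lambda>x. sY a (T x))"

definition directed_preorder :: "'i set \<Rightarrow> ('i \<Rightarrow> 'i \<Rightarrow> bool) \<Rightarrow> bool" where
  "directed_preorder I r \<longleftrightarrow>
     I \<noteq> {} \<and> (\<forall>i\<in>I. r i i) \<and>
     (\<forall>i\<in>I. \<forall>j\<in>I. \<forall>k\<in>I. r i j \<longrightarrow> r j k \<longrightarrow> r i k) \<and>
     (\<forall>i\<in>I. \<forall>j\<in>I. \<exists>k\<in>I. r i k \<and> r j k)"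

definition increasing_net ::
    "'i set \<Rightarrow> ('i \<Rightarrow> 'i \<Rightarrow> bool) \<Rightarrow> 'a set \<Rightarrow> ('a \<Rightarrow> 'a \<Rightarrow> bool) \<Rightarrow> ('i \<Rightarrow> 'a) \<Rightarrow> bool" where
  "increasing_net I r M le t \<longleftrightarrow>
     directed_preorder I r \<and> t ` I \<subseteq> M \<and> (\<forall>i\<in>I. \<forall>j\<in>I. r i j \<longrightarrow> le (t i) (t j))"

end

theory Submission
  imports Defs
begin

text \<open>
  The supremum of a set \<open>A\<close> of operators is, on the positive cone, the map
  \<open>H x = Sup {T\<^sub>1 x\<^sub>1 + \<dots> + T\<^sub>n x\<^sub>n}\<close> over all \<open>T\<^sub>i \<in> A\<close> and all splittings \<open>x = x\<^sub>1 + \<dots> + x\<^sub>n\<close> into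
  positive parts. Riesz decomposition makes \<open>H\<close> additive. For \<open>0 \<le> a \<le> n\<close> both \<open>a (H x) \<le> H (a x)\<close> and
  \<open>(n - a) (H x) \<le> H ((n - a) x)\<close> hold, and their sum is the equality \<open>n (H x) = H (n x)\<close>, hence both
  are equalities. Unbounded scalars are reached by truncation, since \<open>n (a - n)\<^sup>+ \<le> a\<^sup>2\<close> and a
  Dedekind-complete ordered group is Archimedean. Multiples of operators are again operators because
  the algebra is commutative: \<open>w = a b - b a\<close> satisfies \<open>|w| \<le> |a - t| b + b |a - t|\<close> for every real
  \<open>t\<close>, and the infimum over \<open>t\<close> of the right-hand side vanishes.
\<close>

section \<open>Dedekind-complete ordered groups\<close>

text \<open>Each \<open>f n = f (Suc n) - x\<close> lies below the supremum minus \<open>x\<close>,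
  so the supremum is at most itself minus \<open>x\<close>. The multiples are encoded by a recursion
  for \<open>f\<close>, which serves both real scaling in the algebra and the action of
  \<open>real n *\<^sub>R 1\<close> on a module.\<close>

lemma archimedean_multiples:
  fixes x c :: "'a::{ordered_ab_group_add, conditionally_complete_lattice}"
  assumes step: "\<And>n. f (Suc n) = f n + x" and bound: "\<And>n::nat. f n \<le> c"
  shows "x \<le> 0"
proof -
  have bdd: "bdd_above (range f)"
    using bound by (intro bdd_aboveI[of _ c]) auto
  have "Sup (range f) \<le> Sup (range f) - x"
  proof (rule cSup_least)
    fix y assume "y \<in> range f"
    then obtain n where "y = f n" by auto
    moreover have "f (Suc n) \<le> Sup (range f)"
      using bdd by (intro cSup_upper) auto
    ultimately show "y \<le> Sup (range f) - x"
      by (simp add: step le_diff_eq)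
  qed simp
  then show ?thesis by simp
qed

lemma Inf_eq_uminus_Sup:
  fixes A :: "'a::{ordered_ab_group_add, conditionally_complete_lattice} set"
  assumes "A \<noteq> {}" "bdd_above (uminus ` A)"
  shows "Inf A = - Sup (uminus ` A)"
proof (rule cInf_eq_non_empty[OF assms(1)])
  fix a assume "a \<in> A"
  then have "- a \<le> Sup (uminus ` A)"
    using assms(2) by (intro cSup_upper) auto
  then show "- Sup (uminus ` A) \<le> a"
    by (simp add: minus_le_iff)
next
  fix b assume "\<And>a. a \<in> A \<Longrightarrow> b \<le> a"
  then have "Sup (uminus ` A) \<le> - b"
    using assms(1) by (intro cSup_least) auto
  then show "b \<le> - Sup (uminus ` A)"
    by (simp add: le_minus_iff)
qed

section \<open>Unital f-algebras\<close>

lemma pos_part_disjoint_neg_part: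
  fixes x :: "'a::lattice_ab_group_add"
  shows "inf (sup x 0) (sup (- x) 0) = 0"
proof -
  have "sup (- x) 0 = sup x 0 - x"
    by (simp add: diff_conv_add_uminus add_sup_distrib_right sup_commute del: add_uminus_conv_diff)
  moreover have "inf (sup x 0) (sup x 0 - x) = sup x 0 + inf 0 (- x)"
    by (simp add: add_inf_distrib_left)
  moreover have "inf 0 (- x) = - sup x 0"
    by (simp add: inf_commute neg_sup_eq_inf)
  ultimately show ?thesis by (metis add.right_inverse)
qed

lemma eq_pos_part_diff_neg_part:
  fixes x :: "'a::lattice_ab_group_add"
  shows "x = sup x 0 - sup (- x) 0"
proof -
  have "sup (- x) 0 = sup x 0 - x"
    by (simp add: diff_conv_add_uminus add_sup_distrib_right sup_commute del: add_uminus_conv_diff)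
  then show ?thesis by simp
qed

text \<open>The nontrivial half of distributivity. The identity
  \<open>x = inf x c + sup (x - c) 0\<close> bounds \<open>a\<close> and \<open>b\<close> by
  \<open>?u + sup (?s - c) 0\<close>; applied to \<open>?s\<close> itself, it lets the excess over
  \<open>c\<close> cancel.\<close>

lemma inf_sup_le_sup_inf:
  fixes a b c :: "'a::lattice_ab_group_add"
  shows "inf (sup a b) c \<le> sup (inf a c) (inf b c)"
proof -
  let ?s = "sup a b" and ?u = "sup (inf a c) (inf b c)"
  have inf: "x = inf x c + sup (x - c) 0" for x
  proof -
    have "inf x c = x + inf 0 (c - x)"
      by (simp add: add_inf_distrib_left)
    also have "inf 0 (c - x) = - sup (x - c) 0"
      by (simp add: inf_commute neg_sup_eq_inf)
    finally show ?thesis by (metis add.assoc add.left_inverse add_0_right)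
  qed
  have "x \<le> ?u + sup (?s - c) 0" if "x \<le> ?s" "inf x c \<le> ?u" for x
    by (subst inf[of x], rule add_mono) (use that in \<open>auto intro: le_supI1 diff_right_mono\<close>)
  then have "?s \<le> ?u + sup (?s - c) 0"
    by simp
  then have "inf ?s c + sup (?s - c) 0 \<le> ?u + sup (?s - c) 0"
    by (simp only: inf[symmetric])
  then show ?thesis
    by (rule add_le_imp_le_right)
qed

text \<open>\<open>?p - w\<close> lies below both \<open>u\<close> and \<open>v\<close>, hence below
  0; so \<open>?p\<close> lies below \<open>u\<close> and \<open>w\<close>, which are again
  disjoint.\<close>

lemma inf_add_eq_0:
  fixes u v w :: "'a::lattice_ab_group_add"
  assumes "inf u v = 0" "inf u w = 0"
  shows "inf u (v + w) = 0"
proof -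
  have nonneg: "0 \<le> u" "0 \<le> v" "0 \<le> w"
    using assms by (metis inf_le1 inf_le2)+
  let ?p = "inf u (v + w)"
  have "?p - w \<le> v" by (simp add: diff_le_eq)
  moreover have "?p - w \<le> u"
    using nonneg by (simp add: diff_le_eq le_infI1 add_increasing2)
  ultimately have "?p \<le> w"
    using assms(1) by (metis le_inf_iff diff_le_0_iff_le)
  then have "?p \<le> 0"
    using assms(2) by (metis inf_le1 le_inf_iff)
  with nonneg show ?thesis by (simp add: antisym)
qed

section \<open>Disjointness, squares and truncation in f-algebras\<close>

text \<open>Each factor is multiplied up in turn: \<open>a\<close> becomes \<open>a * b\<close>,
  then \<open>b\<close> becomes \<open>a * b\<close>, so the product is disjoint from
  itself.\<close>

lemma mult_eq_0_if_disjoint: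
  fixes a b :: "'l::unital_f_algebra"
  assumes "inf a b = 0"
  shows "a * b = 0"
proof -
  have nonneg: "0 \<le> a" "0 \<le> b"
    using assms by (metis inf_le1 inf_le2)+
  have "inf b (a * b) = 0"
    using f_algebra_right[OF assms nonneg(2)] by (simp add: inf_commute)
  then have "inf (a * b) (a * b) = 0"
    by (rule f_algebra_left) (rule nonneg)
  then show ?thesis by simp
qed

text \<open>The mixed products of positive and negative part vanish. Positivity of \<open>1\<close>
  follows, as \<open>1\<close> is a square.\<close>

lemma square_nonneg: "0 \<le> a * (a :: 'l::unital_f_algebra)"
proof -
  define p q where "p = sup a 0" and "q = sup (- a) 0"
  have nonneg: "0 \<le> p" "0 \<le> q"
    by (simp_all add: p_def q_def)
  have disj: "p * q = 0" "q * p = 0"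
    using pos_part_disjoint_neg_part[of a]
    by (auto intro!: mult_eq_0_if_disjoint simp: inf_commute p_def q_def)
  have "a = p - q"
    unfolding p_def q_def by (rule eq_pos_part_diff_neg_part)
  then have "a * a = (p - q) * (p - q)"
    by simp
  also have "\<dots> = p * p + q * q"
    using disj by (simp add: left_diff_distrib right_diff_distrib)
  also have "\<dots> \<ge> 0" using nonneg by simp
  finally show ?thesis .
qed

lemma one_nonneg: "0 \<le> (1 :: 'l::unital_f_algebra)"
  using square_nonneg[of 1] by simp

lemma scaleR_one_nonneg: "0 \<le> r \<Longrightarrow> 0 \<le> r *\<^sub>R (1 :: 'l::unital_f_algebra)"
  by (simp add: one_nonneg scaleR_nonneg_nonneg)

text \<open>Against its positive part \<open>r\<close>, the element \<open>a - t *\<^sub>R 1\<close>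
  multiplies like \<open>r\<close> itself. The product is therefore a square, which gives
  \<open>t *\<^sub>R r \<le> a * r \<le> a * a\<close>: the excess of \<open>a\<close> over
  \<open>t\<close> decays like \<open>1 / t\<close>.\<close>

lemma scaleR_excess_le_square:
  fixes a :: "'l::unital_f_algebra"
  assumes "0 \<le> a" "0 \<le> t"
  shows "t *\<^sub>R sup (a - t *\<^sub>R 1) 0 \<le> a * a"
proof -
  define r s where "r = sup (a - t *\<^sub>R 1) 0" and "s = sup (- (a - t *\<^sub>R 1)) 0"
  have r: "0 \<le> r" "r \<le> a"
    using assms by (simp_all add: r_def diff_le_eq scaleR_one_nonneg add_increasing2)
  have disj: "s * r = 0"
    using pos_part_disjoint_neg_part[of "a - t *\<^sub>R 1"]
    by (auto intro!: mult_eq_0_if_disjoint simp: inf_commute r_def s_def)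
  have "a - t *\<^sub>R 1 = r - s"
    unfolding r_def s_def by (rule eq_pos_part_diff_neg_part)
  then have "(a - t *\<^sub>R 1) * r = (r - s) * r"
    by simp
  also have "\<dots> = r * r"
    using disj by (simp add: left_diff_distrib)
  also have "\<dots> \<ge> 0" by (rule square_nonneg)
  finally have "t *\<^sub>R r \<le> a * r"
    by (simp add: left_diff_distrib)
  also have "\<dots> \<le> a * a"
    using r assms by (intro mult_left_mono)
  finally show ?thesis by (simp add: r_def)
qed

section \<open>Commutativity of the multiplication\<close>

text \<open>\<open>x\<close> and \<open>y\<close> exceed \<open>inf x y\<close> by disjoint elements
  \<open>u\<close> and \<open>v\<close>, and the f-algebra axioms keep \<open>u * b + b * u\<close>
  and \<open>v * b + b * v\<close> disjoint. Hence \<open>w - ?c\<close> lies below two disjoint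
  elements.\<close>

lemma le_anticommutator_inf:
  fixes b :: "'l::unital_f_algebra"
  assumes "0 \<le> b" and "w \<le> x * b + b * x" "w \<le> y * b + b * y"
  shows "w \<le> inf x y * b + b * inf x y"
proof -
  define u v where "u = x - inf x y" and "v = y - inf x y"
  have "inf u v = 0"
    unfolding u_def v_def diff_conv_add_uminus
    by (simp only: add_inf_distrib_right[symmetric] add.right_inverse)
  then have "inf (u * b) v = 0" "inf (b * u) v = 0"
    using assms(1) by (auto intro: f_algebra_left f_algebra_right)
  then have "inf v (u * b + b * u) = 0"
    by (intro inf_add_eq_0) (simp_all add: inf_commute)
  then have "inf (v * b) (u * b + b * u) = 0" "inf (b * v) (u * b + b * u) = 0"
    using assms(1) by (auto intro: f_algebra_left f_algebra_right)
  then have disj: "inf (u * b + b * u) (v * b + b * v) = 0"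
    by (intro inf_add_eq_0) (simp_all add: inf_commute)
  let ?c = "inf x y * b + b * inf x y"
  have split: "z * b + b * z = (m * b + b * m) + ((z - m) * b + b * (z - m))" for z m :: 'l
    by (simp add: left_diff_distrib right_diff_distrib)
  have "x * b + b * x = ?c + (u * b + b * u)" "y * b + b * y = ?c + (v * b + b * v)"
    unfolding u_def v_def by (rule split)+
  then have "w - ?c \<le> u * b + b * u" "w - ?c \<le> v * b + b * v"
    using assms(2,3) by (simp_all add: diff_le_eq add.commute)
  then have "w - ?c \<le> 0"
    using disj by (metis le_inf_iff)
  then show ?thesis by simp
qed

text \<open>The induction step for a grid of real multiples of \<open>1\<close>, with
  \<open>e\<close> as mesh. By distributivity only \<open>?k\<close> matters: \<open>?k - p\<close>
  is at most \<open>e + e - q\<close> and at most \<open>q\<close>, and averaging removes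
  \<open>q\<close>.\<close>

lemma inf_excess_abs_le:
  fixes x e :: "'a::{lattice_ab_group_add_abs, ordered_real_vector}"
  assumes "0 \<le> e"
  shows "inf (sup (x + e) 0 + e) \<bar>x\<bar> \<le> sup x 0 + e"
proof -
  define p q where "p = sup x 0" and "q = sup (- x) 0"
  have x: "x = p - q"
    unfolding p_def q_def by (rule eq_pos_part_diff_neg_part)
  have nonneg: "0 \<le> p" "0 \<le> q" by (simp_all add: p_def q_def)
  have abs: "\<bar>x\<bar> \<le> p + q"
    using nonneg by (simp add: abs_lattice x add_increasing add_increasing2)
  let ?k = "inf (x + e + e) \<bar>x\<bar>"
  have "?k - p \<le> x + e + e - p"
    by simp
  also have "\<dots> = e + e - q"
    by (simp add: x)
  finally have "?k - p \<le> e + e - q" .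
  moreover have "?k - p \<le> q"
    using le_infI2[OF abs, of "x + e + e"] by (simp add: diff_le_eq add.commute)
  ultimately have "(?k - p) + (?k - p) \<le> (e + e - q) + q"
    by (rule add_mono)
  then have "2 *\<^sub>R (?k - p) \<le> 2 *\<^sub>R e"
    by (simp add: scaleR_2)
  from scaleR_left_mono[OF this, of "1/2"] have k: "?k \<le> p + e"
    by (simp add: diff_le_eq add.commute)
  have "inf (sup (x + e) 0 + e) \<bar>x\<bar> \<le> sup ?k (inf e \<bar>x\<bar>)"
    using inf_sup_le_sup_inf[of "x + e + e" e "\<bar>x\<bar>"] by (simp add: add_sup_distrib_right)
  also have "\<dots> \<le> p + e"
    using k nonneg by (auto intro: le_infI1 add_increasing)
  finally show ?thesis by (simp add: p_def)
qed

text \<open>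
  Since \<open>z \<mapsto> z b + b z\<close> is a lattice homomorphism, the bounds at the grid points \<open>t = k e\<close>
  combine to a bound by its value at \<open>inf\<^sub>k |a - k e| \<le> (a - N e)\<^sup>+ + e\<close>.
\<close>

lemma commutator_le_0:
  fixes a b w :: "'l::{unital_f_algebra, conditionally_complete_lattice}"
  assumes "0 \<le> a" "0 \<le> b" and w: "\<And>t::real. w \<le> \<bar>a - t *\<^sub>R 1\<bar> * b + b * \<bar>a - t *\<^sub>R 1\<bar>"
  shows "w \<le> 0"
proof -
  have small: "w \<le> e *\<^sub>R (b + b)" if e: "0 < e" for e :: real
  proof -
    \<comment> \<open>The bound obtained from the grid points \<open>0\<close>, \<open>e\<close>,
      ..., \<open>k e\<close>; the induction starts with \<open>t = 0\<close>.\<close>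
    have grid: "w \<le> (sup (a - (real k * e) *\<^sub>R 1) 0 + e *\<^sub>R 1) * b
                + b * (sup (a - (real k * e) *\<^sub>R 1) 0 + e *\<^sub>R 1)" for k
    proof (induction k)
      case 0
      have "w \<le> a * b + b * a"
        using w[of 0] \<open>0 \<le> a\<close> by simp
      also have "\<dots> \<le> (a + e *\<^sub>R 1) * b + b * (a + e *\<^sub>R 1)"
        using e \<open>0 \<le> b\<close> by (intro add_mono mult_left_mono mult_right_mono) (simp_all add: scaleR_one_nonneg)
      finally show ?case
        using \<open>0 \<le> a\<close> by (simp add: sup_absorb1)
    next
      case (Suc k)
      let ?x = "a - (real (Suc k) * e) *\<^sub>R 1"
      have eq: "a - (real k * e) *\<^sub>R 1 = ?x + e *\<^sub>R 1"
        by (simp add: algebra_simps)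
      have "w \<le> inf (sup (?x + e *\<^sub>R 1) 0 + e *\<^sub>R 1) \<bar>?x\<bar> * b
              + b * inf (sup (?x + e *\<^sub>R 1) 0 + e *\<^sub>R 1) \<bar>?x\<bar>"
        using Suc.IH w[of "real (Suc k) * e"] \<open>0 \<le> b\<close>
        unfolding eq by (intro le_anticommutator_inf)
      also have "\<dots> \<le> (sup ?x 0 + e *\<^sub>R 1) * b + b * (sup ?x 0 + e *\<^sub>R 1)"
        using e \<open>0 \<le> b\<close>
        by (intro add_mono mult_left_mono mult_right_mono inf_excess_abs_le)
          (simp_all add: scaleR_one_nonneg)
      finally show ?case .
    qed
    \<comment> \<open>The factor \<open>real k * e\<close> turns the excess over
      \<open>real k * e\<close> into something below \<open>a * a\<close>, so all multiples of
      \<open>?d\<close> share one bound.\<close>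
    let ?d = "e *\<^sub>R (w - e *\<^sub>R (b + b))"
    have "real k *\<^sub>R ?d \<le> a * a * b + b * (a * a)" for k
    proof -
      let ?r = "sup (a - (real k * e) *\<^sub>R 1) 0"
      have "w - e *\<^sub>R (b + b) \<le> ?r * b + b * ?r"
        using grid[of k] by (simp add: algebra_simps)
      then have "(real k * e) *\<^sub>R (w - e *\<^sub>R (b + b)) \<le> (real k * e) *\<^sub>R (?r * b + b * ?r)"
        using e by (intro scaleR_left_mono) auto
      also have "\<dots> = ((real k * e) *\<^sub>R ?r) * b + b * ((real k * e) *\<^sub>R ?r)"
        by (simp add: scaleR_add_right)
      also have "\<dots> \<le> a * a * b + b * (a * a)"
        using assms(1,2) e
        by (intro add_mono mult_left_mono mult_right_mono scaleR_excess_le_square) auto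
      finally show ?thesis by simp
    qed
    then have "?d \<le> 0"
      by (intro archimedean_multiples[of "\<lambda>k. real k *\<^sub>R ?d" ?d])
        (simp_all only: of_nat_Suc scaleR_left_distrib scaleR_one add.commute)
    then have "(1/e) *\<^sub>R ?d \<le> (1/e) *\<^sub>R 0"
      using e by (intro scaleR_left_mono) auto
    then show ?thesis
      using e by simp
  qed
  \<comment> \<open>The mesh \<open>1 / n\<close> gives one bound for all multiples of
    \<open>w\<close>, and the Archimedean property applies a second time.\<close>
  have "real n *\<^sub>R w \<le> b + b" for n
  proof (cases "n = 0")
    case False
    then have "real n *\<^sub>R w \<le> real n *\<^sub>R (1 / real n) *\<^sub>R (b + b)"
      by (intro scaleR_left_mono small) auto
    then show ?thesis using False by simp
  qed (simp add: \<open>0 \<le> b\<close>)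
  then show ?thesis
    by (intro archimedean_multiples[of "\<lambda>k. real k *\<^sub>R w" w])
      (simp_all only: of_nat_Suc scaleR_left_distrib scaleR_one add.commute)
qed

text \<open>Subtracting the central element \<open>t *\<^sub>R 1\<close> from \<open>a\<close>
  leaves the commutator unchanged, so the commutator and its negative both satisfy the bound in
  \<open>commutator_le_0\<close> for every \<open>t\<close>.\<close>

lemma nonneg_mult_commute:
  fixes a b :: "'l::{unital_f_algebra, conditionally_complete_lattice}"
  assumes "0 \<le> a" "0 \<le> b"
  shows "a * b = b * a"
proof -
  have eq: "a * b - b * a = (a - t *\<^sub>R 1) * b - b * (a - t *\<^sub>R 1)" for t :: real
    by (simp add: algebra_simps)
  have bounds: "c * b \<le> \<bar>c\<bar> * b" "b * c \<le> b * \<bar>c\<bar>" "- (c * b) \<le> \<bar>c\<bar> * b" "- (b * c) \<le> b * \<bar>c\<bar>" for c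
    using mult_right_mono[of c "\<bar>c\<bar>" b] mult_left_mono[of c "\<bar>c\<bar>" b]
      mult_right_mono[of "- c" "\<bar>c\<bar>" b] mult_left_mono[of "- c" "\<bar>c\<bar>" b] assms
    by (auto simp: abs_ge_self abs_ge_minus_self)
  have "a * b - b * a \<le> \<bar>a - t *\<^sub>R 1\<bar> * b + b * \<bar>a - t *\<^sub>R 1\<bar>" for t
    unfolding eq[of t] using add_mono[OF bounds(1,4)] by simp
  then have "a * b - b * a \<le> 0"
    by (rule commutator_le_0[OF assms])
  moreover have "b * a - a * b \<le> \<bar>a - t *\<^sub>R 1\<bar> * b + b * \<bar>a - t *\<^sub>R 1\<bar>" for t
    using add_mono[OF bounds(3,2)[of "a - t *\<^sub>R 1"]] eq[of t]
    by (metis minus_diff_eq add.commute uminus_add_conv_diff)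
  then have "b * a - a * b \<le> 0"
    by (rule commutator_le_0[OF assms])
  ultimately show ?thesis by (simp add: antisym)
qed

lemma f_algebra_mult_commute:
  fixes a b :: "'l::{unital_f_algebra, conditionally_complete_lattice}"
  shows "a * b = b * a"
proof -
  have comm: "x * b = b * x" if "0 \<le> b" for x b :: 'l
    using nonneg_mult_commute[OF _ that, of "sup x 0"] nonneg_mult_commute[OF _ that, of "sup (- x) 0"]
    by (subst (1 2) eq_pos_part_diff_neg_part[of x])
      (simp only: left_diff_distrib right_diff_distrib sup_ge2)
  show ?thesis
    using comm[of "sup b 0" a] comm[of "sup (- b) 0" a]
    by (subst (1 2) eq_pos_part_diff_neg_part[of b])
      (simp only: left_diff_distrib right_diff_distrib sup_ge2)
qed

section \<open>Ordered modules\<close>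

text \<open>For modules that fill a whole type with its class order. Spaces of operators keep the
  general locale, as their order is not that of the function type.\<close>

locale full_po_module = po_module UNIV smul "(\<le>)"
  for smul :: "'l::unital_f_algebra \<Rightarrow> 'm::ordered_ab_group_add \<Rightarrow> 'm"  (infixr \<open>\<cdot>\<close> 75)
begin

lemma smul_zero [simp]: "a \<cdot> 0 = 0"
  using smul_add_right[of 0 0 a] by simp

lemma smul_minus: "a \<cdot> (- x) = - (a \<cdot> x)"
  using smul_add_right[of x "- x" a] by (simp add: eq_neg_iff_add_eq_0 add.commute)

lemma smul_diff: "a \<cdot> (x - y) = a \<cdot> x - a \<cdot> y"
  using smul_add_right[of x "- y" a] by (simp add: smul_minus)

lemma diff_smul: "(a - b) \<cdot> x = a \<cdot> x - b \<cdot> x"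
  using smul_add_left[of x "a - b" b] by (simp add: eq_diff_eq)

lemma zero_smul [simp]: "0 \<cdot> x = 0"
  using diff_smul[of 0 0 x] by simp

lemma smul_mono: "0 \<le> a \<Longrightarrow> x \<le> y \<Longrightarrow> a \<cdot> x \<le> a \<cdot> y"
  by (simp add: le_smul)

lemma smul_nonneg: "0 \<le> a \<Longrightarrow> 0 \<le> x \<Longrightarrow> 0 \<le> a \<cdot> x"
  using smul_mono[of a 0 x] by simp

lemma smul_mono_left: "a \<le> b \<Longrightarrow> 0 \<le> x \<Longrightarrow> a \<cdot> x \<le> b \<cdot> x"
  using smul_nonneg[of "b - a" x] by (simp add: diff_smul)

lemma smul_eq_pos_neg: "a \<cdot> x = sup a 0 \<cdot> x - sup (- a) 0 \<cdot> x"
  using diff_smul[of "sup a 0" "sup (- a) 0" x] by (simp only: eq_pos_part_diff_neg_part[symmetric])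

lemma scaleR_one_smul_smul: "(r *\<^sub>R 1) \<cdot> a \<cdot> x = (r *\<^sub>R a) \<cdot> x"
  by (simp add: smul_smul)

lemma smul_real_Suc: "(real (Suc n) *\<^sub>R 1) \<cdot> x = (real n *\<^sub>R 1) \<cdot> x + x"
  by (simp only: of_nat_Suc scaleR_left_distrib scaleR_one smul_add_left smul_one UNIV_I add.commute)

lemma smul_inverse_real: "r \<noteq> 0 \<Longrightarrow> (r *\<^sub>R 1) \<cdot> ((1 / r) *\<^sub>R 1) \<cdot> x = x"
  by (simp add: smul_smul smul_one)

text \<open>Positive reals act as order isomorphisms. This is how to divide by \<open>n\<close> in a
  module that carries no real scaling of its own.\<close>

lemma scaleR_one_smul_le_iff:
  assumes "0 < r"
  shows "(r *\<^sub>R 1) \<cdot> x \<le> y \<longleftrightarrow> x \<le> ((1 / r) *\<^sub>R 1) \<cdot> y"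
proof
  assume "(r *\<^sub>R 1) \<cdot> x \<le> y"
  then have "((1 / r) *\<^sub>R 1) \<cdot> (r *\<^sub>R 1) \<cdot> x \<le> ((1 / r) *\<^sub>R 1) \<cdot> y"
    using assms by (intro smul_mono scaleR_one_nonneg) auto
  then show "x \<le> ((1 / r) *\<^sub>R 1) \<cdot> y"
    using smul_inverse_real[of "1 / r" x] assms by simp
next
  assume "x \<le> ((1 / r) *\<^sub>R 1) \<cdot> y"
  then have "(r *\<^sub>R 1) \<cdot> x \<le> (r *\<^sub>R 1) \<cdot> ((1 / r) *\<^sub>R 1) \<cdot> y"
    using assms by (intro smul_mono scaleR_one_nonneg) auto
  then show "(r *\<^sub>R 1) \<cdot> x \<le> y"
    using smul_inverse_real[of r y] assms by simp
qed

lemma double_half_smul: "((1 / 2) *\<^sub>R 1) \<cdot> x + ((1 / 2) *\<^sub>R 1) \<cdot> x = x"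
  using smul_inverse_real[of 2 x] by (simp add: scaleR_2 smul_add_left smul_one)

end

section \<open>Suprema of sets of operators\<close>

text \<open>The sums over all finite splittings of \<open>x\<close>, generated by single terms and
  addition instead of indexed lists. Closure under addition is built in, and \<open>A\<close> may be
  arbitrary rather than closed under finite joins.\<close>

inductive split_value :: "('x::ordered_ab_group_add \<Rightarrow> 'y::plus) set \<Rightarrow> 'x \<Rightarrow> 'y \<Rightarrow> bool" for A where
  base: "T \<in> A \<Longrightarrow> 0 \<le> x \<Longrightarrow> split_value A x (T x)"
| add: "split_value A x u \<Longrightarrow> split_value A y v \<Longrightarrow> split_value A (x + y) (u + v)"

lemma split_value_nonneg: "split_value A x u \<Longrightarrow> 0 \<le> x"
  by (induction rule: split_value.induct) auto

text \<open>Serves twice: for the pointwise boundedness of split values, and for the minimality of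
  their supremum among operators.\<close>

lemma split_value_le:
  fixes U :: "'x::ordered_ab_group_add \<Rightarrow> 'y::ordered_ab_group_add"
  assumes "split_value A x u"
    and "\<And>T x. T \<in> A \<Longrightarrow> 0 \<le> x \<Longrightarrow> T x \<le> U x" and "\<And>x y. U (x + y) = U x + U y"
  shows "u \<le> U x"
  using assms by (induction rule: split_value.induct) (auto intro: add_mono)

locale operator_setting =
  X: full_po_module sX + Y: full_po_module sY
  for sX :: "'l::{unital_f_algebra, conditionally_complete_lattice} \<Rightarrow> 'x::ordered_ab_group_add \<Rightarrow> 'x"
    and sY :: "'l \<Rightarrow> 'y::{ordered_ab_group_add, conditionally_complete_lattice} \<Rightarrow> 'y" +
  assumes directed: "\<exists>z::'x. x \<le> z \<and> y \<le> z"
    and RDP: "0 \<le> x \<Longrightarrow> 0 \<le> y \<Longrightarrow> {0..x + y :: 'x} = {0..x} + {0..y}"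
begin

abbreviation "is_operator \<equiv> operator sX sY"
abbreviation "Lb \<equiv> order_bounded_operators sX sY"
abbreviation "op_le \<equiv> operator_le sX sY"

lemma operator_add: "is_operator T \<Longrightarrow> T (x + y) = T x + T y"
  and operator_apply_smul: "is_operator T \<Longrightarrow> T (sX a x) = sY a (T x)"
  by (simp_all add: operator_def)

lemma operator_0: "is_operator T \<Longrightarrow> T 0 = 0"
  using operator_add[of T 0 0] by simp

lemma operator_minus: "is_operator T \<Longrightarrow> T (- x) = - T x"
  using operator_add[of T x "- x"] by (simp add: operator_0 eq_neg_iff_add_eq_0 add.commute)

lemma operator_diff: "is_operator T \<Longrightarrow> T (x - y) = T x - T y"
  using operator_add[of T x "- y"] by (simp add: operator_minus)

section \<open>Passage between the positive cone and the whole module\<close>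

lemma ex_nonneg_diff: "\<exists>u v. 0 \<le> u \<and> 0 \<le> v \<and> x = u - (v :: 'x)"
proof -
  obtain z where "x \<le> z" "0 \<le> z"
    using directed by blast
  then show ?thesis
    by (intro exI[of _ z] exI[of _ "z - x"]) simp
qed

lemma operator_eqI:
  assumes "is_operator S" "is_operator T" "\<And>x. 0 \<le> x \<Longrightarrow> S x = T x"
  shows "S = T"
proof
  fix x :: 'x
  obtain u v where "0 \<le> u" "0 \<le> v" "x = u - v"
    using ex_nonneg_diff by blast
  with assms show "S x = T x" by (simp add: operator_diff)
qed

text \<open>
  The truncation \<open>a \<and> n\<close> of \<open>a\<close> misses \<open>(a - n)\<^sup>+ \<le> a\<^sup>2 / n\<close>, so the error in homogeneity is
  bounded by multiples of \<open>1 / n\<close>.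
\<close>

lemma homogeneous_if_boundedly_homogeneous:
  assumes add: "\<And>x y. 0 \<le> x \<Longrightarrow> 0 \<le> y \<Longrightarrow> G (x + y) = G x + (G y :: 'y)"
    and pos: "\<And>x. 0 \<le> x \<Longrightarrow> 0 \<le> G x"
    and bounded: "\<And>a x n. 0 \<le> a \<Longrightarrow> a \<le> real n *\<^sub>R 1 \<Longrightarrow> 0 \<le> x \<Longrightarrow> G (sX a x) = sY a (G x)"
    and "0 \<le> a" "0 \<le> x"
  shows "G (sX a x) = sY a (G x)"
proof -
  have mono: "G x \<le> G y" if "0 \<le> x" "x \<le> y" for x y
    using add[of x "y - x"] pos[of "y - x"] that by simp
  define d where "d = G (sX a x) - sY a (G x)"
  have bounds: "sY (real n *\<^sub>R 1) d \<le> G (sX (a * a) x)"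
    "sY (real n *\<^sub>R 1) (- d) \<le> sY (a * a) (G x)" for n
  proof -
    \<comment> \<open>\<open>r\<close> is the part of \<open>a\<close> above \<open>n\<close>, and
      \<open>a - r\<close> is the truncation of \<open>a\<close> at \<open>n\<close>, to which
      \<open>bounded\<close> applies.\<close>
    define r where "r = sup (a - real n *\<^sub>R 1) 0"
    have r: "0 \<le> r" "r \<le> a" "a - r \<le> real n *\<^sub>R 1"
    proof -
      show "0 \<le> r" by (simp add: r_def)
      show "r \<le> a"
        using \<open>0 \<le> a\<close> by (simp add: r_def diff_le_eq scaleR_one_nonneg add_increasing2)
      have "a - real n *\<^sub>R 1 \<le> r" by (simp add: r_def)
      then show "a - r \<le> real n *\<^sub>R 1" by (simp add: diff_le_eq add.commute)
    qed
    have nr: "0 \<le> real n *\<^sub>R r" "real n *\<^sub>R r \<le> a * a"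
      using scaleR_excess_le_square[OF \<open>0 \<le> a\<close>, of "real n"] r(1)
      by (simp_all add: r_def scaleR_nonneg_nonneg)
    have "sX a x = sX (a - r) x + sX r x"
      by (simp add: X.diff_smul)
    then have "G (sX a x) = sY (a - r) (G x) + G (sX r x)"
      using r \<open>0 \<le> x\<close> bounded[of "a - r" n x] by (simp add: add X.smul_nonneg)
    then have "d = G (sX r x) - sY r (G x)"
      by (simp add: d_def Y.diff_smul)
    moreover have "sY (real n *\<^sub>R 1) (G (sX r x)) = G (sX (real n *\<^sub>R r) x)"
      using bounded[of "real n *\<^sub>R 1" n "sX r x"] r \<open>0 \<le> x\<close>
      by (simp add: scaleR_one_nonneg X.smul_nonneg X.scaleR_one_smul_smul)
    \<comment> \<open>Scaled by \<open>n\<close>, the error is a difference of two nonnegative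
      terms, each bounded independently of \<open>n\<close> because
      \<open>real n *\<^sub>R r \<le> a * a\<close>. So the multiples of \<open>d\<close> and of
      \<open>- d\<close> are both bounded.\<close>
    ultimately have nd: "sY (real n *\<^sub>R 1) d = G (sX (real n *\<^sub>R r) x) - sY (real n *\<^sub>R r) (G x)"
      by (simp add: Y.smul_diff Y.scaleR_one_smul_smul)
    have G: "0 \<le> G (sX (real n *\<^sub>R r) x)" "G (sX (real n *\<^sub>R r) x) \<le> G (sX (a * a) x)"
      using nr \<open>0 \<le> x\<close> by (auto intro: pos mono X.smul_nonneg X.smul_mono_left)
    have sG: "0 \<le> sY (real n *\<^sub>R r) (G x)" "sY (real n *\<^sub>R r) (G x) \<le> sY (a * a) (G x)"
      using nr pos[OF \<open>0 \<le> x\<close>] by (auto intro: Y.smul_nonneg Y.smul_mono_left)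
    show "sY (real n *\<^sub>R 1) d \<le> G (sX (a * a) x)"
      unfolding nd using G sG by (simp add: diff_le_eq add_increasing2)
    show "sY (real n *\<^sub>R 1) (- d) \<le> sY (a * a) (G x)"
      unfolding Y.smul_minus nd using G sG by (simp add: diff_le_eq add_increasing2)
  qed
  have "d \<le> 0"
    by (rule archimedean_multiples[of "\<lambda>n. sY (real n *\<^sub>R 1) d", OF Y.smul_real_Suc bounds(1)])
  moreover have "- d \<le> 0"
    by (rule archimedean_multiples[of "\<lambda>n. sY (real n *\<^sub>R 1) (- d)", OF Y.smul_real_Suc bounds(2)])
  ultimately show ?thesis
    by (simp add: d_def antisym)
qed

text \<open>Directedness writes every \<open>x\<close> as a difference of positive elements, and
  additivity makes \<open>G u - G v\<close> depend on \<open>u - v\<close> alone. A general scalar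
  is split in the same way and the four products are regrouped by sign.\<close>

lemma extend_from_cone:
  assumes add: "\<And>x y. 0 \<le> x \<Longrightarrow> 0 \<le> y \<Longrightarrow> G (x + y) = G x + (G y :: 'y)"
    and hom: "\<And>a x. 0 \<le> a \<Longrightarrow> 0 \<le> x \<Longrightarrow> G (sX a x) = sY a (G x)"
  shows "\<exists>F. is_operator F \<and> (\<forall>x\<ge>0. F x = G x)"
proof -
  obtain p :: "'x \<Rightarrow> 'x" where p: "\<And>x. 0 \<le> p x" "\<And>x. x \<le> p x"
    using directed by metis
  define q where "q x = p x - x" for x
  have pq: "0 \<le> p x" "0 \<le> q x" "x = p x - q x" for x
    using p by (simp_all add: q_def)
  define F where "F x = G (p x) - G (q x)" for x
  have F: "F (u - v) = G u - G v" if "0 \<le> u" "0 \<le> v" for u v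
  proof -
    let ?p = "p (u - v)" and ?q = "q (u - v)"
    have "?p + v = u + ?q"
      using pq(3)[of "u - v"] by (simp add: algebra_simps)
    then have "G ?p + G v = G u + G ?q"
      using that pq by (metis add)
    then show ?thesis by (simp add: F_def algebra_simps)
  qed
  have "F (x + y) = F x + F y" for x y
  proof -
    have "x + y = (p x + p y) - (q x + q y)"
      by (subst (1) pq(3)[of x], subst (1) pq(3)[of y]) simp
    then have "F (x + y) = G (p x + p y) - G (q x + q y)"
      using pq by (simp add: F)
    then show ?thesis using pq by (simp add: add F_def)
  qed
  moreover have "F (sX a x) = sY a (F x)" for a x
  proof -
    define b c where "b = sup a 0" and "c = sup (- a) 0"
    have a: "a = b - c" and nonneg: "0 \<le> b" "0 \<le> c"
      unfolding b_def c_def by (rule eq_pos_part_diff_neg_part) simp_all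
    have "sX a x = (sX b (p x) + sX c (q x)) - (sX c (p x) + sX b (q x))"
      by (subst (1) pq(3)[of x]) (simp add: a X.diff_smul X.smul_diff)
    then have "F (sX a x) = G (sX b (p x) + sX c (q x)) - G (sX c (p x) + sX b (q x))"
      using pq nonneg by (simp add: F X.smul_nonneg)
    also have "\<dots> = (sY b (G (p x)) + sY c (G (q x))) - (sY c (G (p x)) + sY b (G (q x)))"
      using pq nonneg by (simp add: add hom X.smul_nonneg)
    also have "\<dots> = sY a (F x)"
      by (simp add: a F_def Y.diff_smul Y.smul_diff)
    finally show ?thesis .
  qed
  moreover have "F x = G x" if "0 \<le> x" for x
    using F[of x 0] add[of 0 0] that by simp
  ultimately show ?thesis
    unfolding operator_def by blast
qed

section \<open>The supremum over splittings as an operator\<close>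

text \<open>Here Riesz decomposition enters. In the addition step \<open>p\<close> lies in
  \<open>{0..x + y}\<close> and so splits as \<open>x1 + y1\<close>, which leaves
  \<open>x - x1\<close> and \<open>y - y1\<close> as the parts of \<open>q\<close>.\<close>

lemma split_value_decompose:
  assumes "split_value A z w" and "\<And>T. T \<in> A \<Longrightarrow> is_operator T"
    and "z = x + y" "0 \<le> x" "0 \<le> y"
  shows "\<exists>u v. split_value A x u \<and> split_value A y v \<and> w = u + (v :: 'y)"
  using assms(1,3-)
proof (induction arbitrary: x y rule: split_value.induct)
  case (base T z)
  then show ?case
    using assms(2) by (metis operator_add split_value.base)
next
  case (add p u q v)
  have nonneg: "0 \<le> p" "0 \<le> q"
    using add.hyps by (auto dest: split_value_nonneg)
  then have "p \<in> {0..x} + {0..y}"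
    using RDP[of x y] add.prems by (metis atLeastAtMost_iff le_add_same_cancel1)
  then obtain x1 y1 where 1: "p = x1 + y1" "0 \<le> x1" "x1 \<le> x" "0 \<le> y1" "y1 \<le> y"
    by (auto elim: set_plus_elim)
  have 2: "q = (x - x1) + (y - y1)"
    using add.prems 1 by (simp add: algebra_simps)
  obtain u1 u2 where u: "split_value A x1 u1" "split_value A y1 u2" "u = u1 + u2"
    using add.IH(1)[OF 1(1,2,4)] by blast
  obtain v1 v2 where v: "split_value A (x - x1) v1" "split_value A (y - y1) v2" "v = v1 + v2"
    using add.IH(2)[OF 2] 1 by auto
  have "split_value A x (u1 + v1)" "split_value A y (u2 + v2)"
    using split_value.add[OF u(1) v(1)] split_value.add[OF u(2) v(2)] by simp_all
  then show ?case
    using u(3) v(3) by (intro exI[of _ "u1 + v1"] exI[of _ "u2 + v2"]) (simp add: algebra_simps)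
qed

lemma split_value_smul:
  assumes "split_value A x u" and "\<And>T. T \<in> A \<Longrightarrow> is_operator T" and "0 \<le> a"
  shows "split_value A (sX a x) (sY a u)"
  using assms(1)
proof (induction rule: split_value.induct)
  case (base T x)
  then show ?case
    using split_value.base[of T A "sX a x"] assms(2,3) by (simp add: operator_apply_smul X.smul_nonneg)
next
  case (add x u y v)
  then show ?case
    by (simp add: X.smul_add_right Y.smul_add_right split_value.add)
qed

lemma ex_operator_Sup_split_values:
  assumes A: "A \<noteq> {}" "\<And>T. T \<in> A \<Longrightarrow> is_operator T"
    and bdd: "\<And>x. 0 \<le> x \<Longrightarrow> bdd_above {u :: 'y. split_value A x u}"
  shows "\<exists>F. is_operator F \<and> (\<forall>x\<ge>0. F x = Sup {u. split_value A x u})"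
proof -
  obtain T where T: "T \<in> A" "is_operator T"
    using A by blast
  define H where "H x = Sup {u. split_value A x u}" for x
  have upper: "u \<le> H x" if "split_value A x u" for x u
    unfolding H_def using that bdd split_value_nonneg[OF that] by (intro cSup_upper) auto
  have least: "H x \<le> c" if "0 \<le> x" "\<And>u. split_value A x u \<Longrightarrow> u \<le> c" for x c
    unfolding H_def using that split_value.base[OF T(1) that(1)] by (intro cSup_least) auto
  have H_add: "H (x + y) = H x + H y" if nonneg: "0 \<le> x" "0 \<le> y" for x y
  proof (rule antisym)
    show "H (x + y) \<le> H x + H y"
    proof (rule least)
      fix w assume "split_value A (x + y) w"
      then show "w \<le> H x + H y"
        using split_value_decompose[OF _ A(2) refl nonneg] by (metis add_mono upper)
    qed (use nonneg in simp)
    \<comment> \<open>The suprema are taken one after the other: first over the split values at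
      \<open>y\<close> with \<open>u\<close> fixed, then over \<open>u\<close>.\<close>
    have "H x \<le> H (x + y) - H y"
    proof (rule least[OF nonneg(1)])
      fix u assume u: "split_value A x u"
      have "H y \<le> H (x + y) - u"
        by (rule least[OF nonneg(2)])
          (use upper[OF split_value.add[OF _ u]] in \<open>simp add: le_diff_eq add.commute[of x y]\<close>)
      then show "u \<le> H (x + y) - H y"
        by (simp add: le_diff_eq add.commute)
    qed
    then show "H x + H y \<le> H (x + y)"
      by (simp add: le_diff_eq)
  qed
  have scale_real: "H (sX (real n *\<^sub>R 1) x) = sY (real n *\<^sub>R 1) (H x)" if "0 \<le> x" for n x
  proof (induction n)
    case 0
    then show ?case using H_add[of 0 0] by simp
  next
    case (Suc n)
    then show ?case
      using that unfolding X.smul_real_Suc Y.smul_real_Suc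
      by (simp add: H_add X.smul_nonneg scaleR_one_nonneg)
  qed
  \<comment> \<open>With \<open>D\<close> the split values at \<open>x\<close>, the suprema \<open>s\<close>, \<open>t\<close> of \<open>a D\<close>, \<open>(n - a) D\<close> satisfy \<open>s + t \<ge> n (Sup D)\<close>.\<close>
  have bounded: "H (sX a x) = sY a (H x)"
    if a: "0 \<le> a" "a \<le> real n *\<^sub>R 1" and x: "0 \<le> x" for a x n
  proof (cases "n = 0")
    \<comment> \<open>Kept apart because the argument below divides by \<open>n\<close>.\<close>
    case True
    with a have "a = 0" by (simp add: antisym)
    then show ?thesis using H_add[of 0 0] by simp
  next
    case False
    let ?N = "real n *\<^sub>R (1 :: 'l)"
    have sup_le: "\<exists>s. (\<forall>u. split_value A x u \<longrightarrow> sY b u \<le> s) \<and> s \<le> sY b (H x) \<and> s \<le> H (sX b x)"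
      if b: "0 \<le> b" for b
    proof -
      let ?B = "sY b ` {u. split_value A x u}"
      have B: "v \<le> sY b (H x)" "v \<le> H (sX b x)" if "v \<in> ?B" for v
        using that b by (auto intro: Y.smul_mono upper split_value_smul[OF _ A(2)])
      have "?B \<noteq> {}" using split_value.base[OF T(1) x] by auto
      moreover have "bdd_above ?B" using B(1) by (intro bdd_aboveI)
      ultimately show ?thesis
        using B by (intro exI[of _ "Sup ?B"]) (auto intro!: cSup_upper cSup_least)
    qed
    obtain s where s: "\<And>u. split_value A x u \<Longrightarrow> sY a u \<le> s" "s \<le> sY a (H x)" "s \<le> H (sX a x)"
      using sup_le[OF a(1)] by blast
    obtain t where t: "\<And>u. split_value A x u \<Longrightarrow> sY (?N - a) u \<le> t"
        "t \<le> sY (?N - a) (H x)" "t \<le> H (sX (?N - a) x)"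
      using sup_le[of "?N - a"] a by auto
    have split: "sY ?N u = sY a u + sY (?N - a) u" for u
      by (simp add: Y.diff_smul)
    have "H x \<le> sY ((1 / real n) *\<^sub>R 1) (s + t)"
    proof (rule least[OF x])
      fix u assume "split_value A x u"
      then have "sY ?N u \<le> s + t"
        unfolding split by (intro add_mono s t)
      then show "u \<le> sY ((1 / real n) *\<^sub>R 1) (s + t)"
        using False by (simp add: Y.scaleR_one_smul_le_iff)
    qed
    then have ge: "sY ?N (H x) \<le> s + t"
      using False by (simp add: Y.scaleR_one_smul_le_iff)
    have sum: "H (sX a x) + H (sX (?N - a) x) = sY ?N (H x)"
      using H_add[of "sX a x" "sX (?N - a) x"] a x scale_real[OF x, of n]
      by (simp add: X.smul_nonneg X.diff_smul X.smul_mono_left)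
    \<comment> \<open>Two lower bounds whose sum reaches the sum of the bounded terms must be
      attained. This is used once for the multiples of \<open>H x\<close> and once for the values of
      \<open>H\<close>, both pairs having the same sum.\<close>
    have eq: "c = s" if "c + d \<le> s + t" "s \<le> c" "t \<le> d" for c d
    proof (rule antisym)
      have "c + d \<le> s + d"
        using that(1) add_left_mono[OF that(3), of s] by (rule order_trans)
      then show "c \<le> s" by simp
    qed (rule that)
    have "sY a (H x) = s"
      using ge s(2) t(2) unfolding split by (rule eq)
    moreover have "H (sX a x) = s"
      using ge s(3) t(3) unfolding sum[symmetric] by (rule eq)
    ultimately show ?thesis by simp
  qed
  \<comment> \<open>The truncation argument needs a positive map. \<open>H\<close> need not be
    positive, but it dominates the member \<open>T\<close> of \<open>A\<close>.\<close>
  define G where "G x = H x - T x" for x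
  have hom_G: "G (sX a x) = sY a (G x)" if "0 \<le> a" "0 \<le> x" for a x
  proof (rule homogeneous_if_boundedly_homogeneous[OF _ _ _ that])
    show "G (x + y) = G x + G y" if "0 \<le> x" "0 \<le> y" for x y
      using that T by (simp add: G_def H_add operator_add)
    show "0 \<le> G x" if "0 \<le> x" for x
      using upper[OF split_value.base[OF T(1) that]] by (simp add: G_def)
    show "G (sX a x) = sY a (G x)" if "0 \<le> a" "a \<le> real n *\<^sub>R 1" "0 \<le> x" for a x n
      using bounded[OF that] T by (simp add: G_def operator_apply_smul Y.smul_diff)
  qed
  have "H (sX a x) = sY a (H x)" if "0 \<le> a" "0 \<le> x" for a x
    using hom_G[OF that] T by (simp add: G_def operator_apply_smul Y.smul_diff)
  then have "\<exists>F. is_operator F \<and> (\<forall>x\<ge>0. F x = H x)"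
    by (intro extend_from_cone H_add)
  then show ?thesis by (simp add: H_def)
qed

end

section \<open>The lattice of order-bounded operators\<close>

lemma (in po_module) is_sup_unique:
  "is_sup M le A s \<Longrightarrow> is_sup M le A t \<Longrightarrow> s = t"
  by (auto simp: is_sup_def intro: le_antisym)

lemma (in po_module) is_inf_unique:
  "is_inf M le A s \<Longrightarrow> is_inf M le A t \<Longrightarrow> s = t"
  by (auto simp: is_inf_def intro: le_antisym)

lemma (in po_module) join_on_eq: "is_sup M le {a, b} s \<Longrightarrow> join_on M le a b = s"
  unfolding join_on_def by (rule the_equality) (auto intro: is_sup_unique)

lemma (in po_module) meet_on_eq: "is_inf M le {a, b} s \<Longrightarrow> meet_on M le a b = s"
  unfolding meet_on_def by (rule the_equality) (auto intro: is_inf_unique)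

context operator_setting
begin

section \<open>The module of order-bounded operators\<close>

lemma is_operator_if_Lb: "T \<in> Lb \<Longrightarrow> is_operator T"
  by (simp add: order_bounded_operators_def)

lemma is_operator_zero: "is_operator 0"
  by (simp add: operator_def)

lemma is_operator_add: "is_operator S \<Longrightarrow> is_operator T \<Longrightarrow> is_operator (S + T)"
  by (simp add: operator_def Y.smul_add_right add.assoc add.left_commute)

lemma is_operator_uminus: "is_operator T \<Longrightarrow> is_operator (- T)"
  by (simp add: operator_def Y.smul_minus)

lemma is_operator_diff: "is_operator S \<Longrightarrow> is_operator T \<Longrightarrow> is_operator (S - T)"
  using is_operator_add[of S "- T"] by (simp add: is_operator_uminus)

text \<open>Homogeneity of the multiple exchanges \<open>a\<close> with another scalar; this is
  where commutativity of the algebra enters.\<close>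

lemma is_operator_smul: "is_operator T \<Longrightarrow> is_operator (operator_smul sY a T)"
  by (simp add: operator_def operator_smul_def Y.smul_add_right Y.smul_smul f_algebra_mult_commute)

lemma Lb_boundedE:
  assumes "T \<in> Lb"
  obtains c d where "\<And>x. a \<le> x \<Longrightarrow> x \<le> b \<Longrightarrow> c \<le> T x" "\<And>x. a \<le> x \<Longrightarrow> x \<le> b \<Longrightarrow> T x \<le> d"
proof -
  obtain c d where "T ` {a..b} \<subseteq> {c..d}"
    using assms unfolding order_bounded_operators_def by blast
  then show ?thesis by (intro that[of c d]) (auto simp: image_subset_iff)
qed

lemma LbI:
  assumes "is_operator T"
    and "\<And>a b. \<exists>c d. \<forall>x. a \<le> x \<longrightarrow> x \<le> b \<longrightarrow> c \<le> T x \<and> T x \<le> d"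
  shows "T \<in> Lb"
proof -
  have "\<exists>c d. T ` {a..b} \<subseteq> {c..d}" for a b
  proof -
    obtain c d where "\<forall>x. a \<le> x \<longrightarrow> x \<le> b \<longrightarrow> c \<le> T x \<and> T x \<le> d"
      using assms(2) by blast
    then show ?thesis by (intro exI[of _ c] exI[of _ d]) auto
  qed
  with assms(1) show ?thesis by (simp add: order_bounded_operators_def)
qed

lemma Lb_if_positive:
  assumes "positive_operator sX sY T"
  shows "T \<in> Lb"
proof (rule LbI)
  show T: "is_operator T" using assms by (simp add: positive_operator_def)
  have "T x \<le> T y" if "x \<le> y" for x y
    using assms that operator_diff[OF T, of y x] unfolding positive_operator_def
    by (metis diff_ge_0_iff_ge)
  then show "\<exists>c d. \<forall>x. a \<le> x \<longrightarrow> x \<le> b \<longrightarrow> c \<le> T x \<and> T x \<le> d" for a b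
    by blast
qed

lemma Lb_zero: "0 \<in> Lb"
  by (intro Lb_if_positive) (simp add: positive_operator_def is_operator_zero)

lemma Lb_add:
  assumes "S \<in> Lb" "T \<in> Lb"
  shows "S + T \<in> Lb"
proof (rule LbI)
  show "is_operator (S + T)" using assms by (intro is_operator_add is_operator_if_Lb)
  fix a b
  obtain c d where S: "\<And>x. a \<le> x \<Longrightarrow> x \<le> b \<Longrightarrow> c \<le> S x" "\<And>x. a \<le> x \<Longrightarrow> x \<le> b \<Longrightarrow> S x \<le> d"
    using Lb_boundedE[OF assms(1)] by blast
  obtain c' d' where T: "\<And>x. a \<le> x \<Longrightarrow> x \<le> b \<Longrightarrow> c' \<le> T x" "\<And>x. a \<le> x \<Longrightarrow> x \<le> b \<Longrightarrow> T x \<le> d'"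
    using Lb_boundedE[OF assms(2)] by blast
  show "\<exists>c d. \<forall>x. a \<le> x \<longrightarrow> x \<le> b \<longrightarrow> c \<le> (S + T) x \<and> (S + T) x \<le> d"
    by (intro exI[of _ "c + c'"] exI[of _ "d + d'"]) (simp add: S T add_mono)
qed

lemma Lb_uminus:
  assumes "T \<in> Lb"
  shows "- T \<in> Lb"
proof (rule LbI)
  show "is_operator (- T)" using assms by (intro is_operator_uminus is_operator_if_Lb)
  fix a b
  obtain c d where T: "\<And>x. a \<le> x \<Longrightarrow> x \<le> b \<Longrightarrow> c \<le> T x" "\<And>x. a \<le> x \<Longrightarrow> x \<le> b \<Longrightarrow> T x \<le> d"
    using Lb_boundedE[OF assms] by blast
  show "\<exists>c d. \<forall>x. a \<le> x \<longrightarrow> x \<le> b \<longrightarrow> c \<le> (- T) x \<and> (- T) x \<le> d"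
    by (intro exI[of _ "- d"] exI[of _ "- c"]) (simp add: T)
qed

lemma Lb_diff: "S \<in> Lb \<Longrightarrow> T \<in> Lb \<Longrightarrow> S - T \<in> Lb"
  using Lb_add[of S "- T"] by (simp add: Lb_uminus)

lemma Lb_smul_nonneg:
  assumes "T \<in> Lb" "0 \<le> r"
  shows "operator_smul sY r T \<in> Lb"
proof (rule LbI)
  show "is_operator (operator_smul sY r T)"
    using assms by (intro is_operator_smul is_operator_if_Lb)
  fix a b
  obtain c d where T: "\<And>x. a \<le> x \<Longrightarrow> x \<le> b \<Longrightarrow> c \<le> T x" "\<And>x. a \<le> x \<Longrightarrow> x \<le> b \<Longrightarrow> T x \<le> d"
    using Lb_boundedE[OF assms(1)] by blast
  show "\<exists>c d. \<forall>x. a \<le> x \<longrightarrow> x \<le> b \<longrightarrow> c \<le> operator_smul sY r T x \<and> operator_smul sY r T x \<le> d"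
    by (intro exI[of _ "sY r c"] exI[of _ "sY r d"])
      (simp add: T assms(2) Y.smul_mono operator_smul_def)
qed

text \<open>Only nonnegative scalars map order bounds to order bounds, so \<open>r\<close> is split
  into its positive and negative part.\<close>

lemma Lb_smul:
  assumes "T \<in> Lb"
  shows "operator_smul sY r T \<in> Lb"
proof -
  have "operator_smul sY r T = operator_smul sY (sup r 0) T - operator_smul sY (sup (- r) 0) T"
    by (rule ext) (simp add: operator_smul_def Y.smul_eq_pos_neg[of r])
  then show ?thesis
    using assms by (simp add: Lb_diff Lb_smul_nonneg)
qed

lemma op_le_iff:
  assumes "S \<in> Lb" "T \<in> Lb"
  shows "op_le S T \<longleftrightarrow> (\<forall>x\<ge>0. S x \<le> T x)"
  using assms by (simp add: operator_le_def positive_operator_def is_operator_diff is_operator_if_Lb)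

text \<open>\<open>F\<close> is \<open>T\<close> plus a positive operator. Hence a supremum is
  order-bounded once it dominates one member of the set.\<close>

lemma Lb_if_op_ge:
  assumes "T \<in> Lb" "op_le T F"
  shows "F \<in> Lb"
proof -
  have "T + (F - T) \<in> Lb"
    using assms by (intro Lb_add) (auto simp: operator_le_def intro: Lb_if_positive)
  then show ?thesis by simp
qed

lemma po_module_Lb: "po_module Lb (operator_smul sY) op_le"
proof
  fix S T
  assume "S \<in> Lb" "T \<in> Lb" "op_le S T" "op_le T S"
  then show "S = T"
    by (intro operator_eqI) (auto simp: op_le_iff is_operator_if_Lb intro: antisym)
next
  fix S T U
  assume "S \<in> Lb" "T \<in> Lb" "U \<in> Lb" "op_le S T" "op_le T U"
  then show "op_le S U" by (auto simp: op_le_iff intro: order_trans)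
next
  fix S T :: "'x \<Rightarrow> 'y" and a :: 'l
  show "operator_smul sY a (S + T) = operator_smul sY a S + operator_smul sY a T"
    by (rule ext) (simp add: operator_smul_def Y.smul_add_right)
next
  fix T :: "'x \<Rightarrow> 'y" and a b :: 'l
  show "operator_smul sY (a + b) T = operator_smul sY a T + operator_smul sY b T"
    by (rule ext) (simp add: operator_smul_def Y.smul_add_left)
  show "operator_smul sY a (operator_smul sY b T) = operator_smul sY (a * b) T"
    by (rule ext) (simp add: operator_smul_def Y.smul_smul)
  show "operator_smul sY 1 T = T"
    by (rule ext) (simp add: operator_smul_def Y.smul_one)
next
  fix S T :: "'x \<Rightarrow> 'y" and a :: 'l
  assume "S \<in> Lb" "T \<in> Lb" "0 \<le> a" "op_le S T"
  then show "op_le (operator_smul sY a S) (operator_smul sY a T)"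
    by (simp add: op_le_iff Lb_smul) (simp add: operator_smul_def Y.smul_mono)
qed (auto simp: Lb_zero Lb_add Lb_uminus Lb_smul op_le_iff)

sublocale Lb: po_module Lb "operator_smul sY" op_le
  by (rule po_module_Lb)

section \<open>Suprema and Dedekind completeness\<close>

text \<open>Boundedness is required pointwise and not through an operator above \<open>A\<close>, so
  that the lemma covers pairs \<open>S\<close>, \<open>T\<close>, for which no common upper bound is
  known beforehand.\<close>

lemma ex_is_sup:
  assumes A: "A \<noteq> {}" "A \<subseteq> Lb"
    and bdd: "\<And>x. 0 \<le> x \<Longrightarrow> bdd_above {u. split_value A x u}"
  shows "\<exists>F. is_sup Lb op_le A F \<and> (\<forall>x\<ge>0. F x = Sup {u. split_value A x u})"
proof -
  have A': "is_operator T" if "T \<in> A" for T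
    using A that is_operator_if_Lb by auto
  obtain F where F: "is_operator F" "\<And>x. 0 \<le> x \<Longrightarrow> F x = Sup {u. split_value A x u}"
    using ex_operator_Sup_split_values[OF A(1) A' bdd] by blast
  have upper: "op_le T F" if "T \<in> A" for T
  proof -
    have "T x \<le> F x" if "0 \<le> x" for x
      unfolding F(2)[OF that] using that \<open>T \<in> A\<close>
      by (intro cSup_upper bdd) (auto intro: split_value.base)
    then show ?thesis
      using F(1) A'[OF that] by (simp add: operator_le_def positive_operator_def is_operator_diff)
  qed
  obtain T where T: "T \<in> A" "T \<in> Lb" using A by auto
  then have Lb: "F \<in> Lb" using upper Lb_if_op_ge by blast
  have "op_le F U" if U: "U \<in> Lb" "\<forall>T\<in>A. op_le T U" for U
  proof -
    have "F x \<le> U x" if "0 \<le> x" for x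
      unfolding F(2)[OF that]
    proof (rule cSup_least)
      show "{u. split_value A x u} \<noteq> {}"
        using split_value.base[OF T(1) that] by auto
      fix u assume "u \<in> {u. split_value A x u}"
      then show "u \<le> U x"
        using U A by (intro split_value_le[of A x u U])
          (auto simp: op_le_iff subset_iff operator_add is_operator_if_Lb)
    qed
    then show ?thesis using U Lb by (simp add: op_le_iff)
  qed
  with Lb upper F(2) show ?thesis by (auto simp: is_sup_def)
qed

lemma ex_is_sup_if_bounded:
  assumes "A \<noteq> {}" "A \<subseteq> Lb" "U \<in> Lb" "\<forall>T\<in>A. op_le T U"
  shows "\<exists>F. is_sup Lb op_le A F \<and> (\<forall>x\<ge>0. F x = Sup {u. split_value A x u})"
proof (rule ex_is_sup[OF assms(1,2)])
  fix x
  have "u \<le> U x" if "split_value A x u" for u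
    using that by (rule split_value_le)
      (use assms in \<open>auto simp: op_le_iff subset_iff operator_add is_operator_if_Lb\<close>)
  then show "bdd_above {u. split_value A x u}" by (intro bdd_aboveI[of _ "U x"]) auto
qed

lemma dedekind_complete_Lb: "dedekind_complete_on Lb op_le"
  unfolding dedekind_complete_on_def
proof (intro allI impI, elim conjE bexE)
  fix A U
  assume "A \<subseteq> Lb" "A \<noteq> {}" "U \<in> Lb" "\<forall>T\<in>A. op_le T U"
  from ex_is_sup_if_bounded[OF this(2,1,3,4)] show "\<exists>s. is_sup Lb op_le A s"
    by (elim exE conjE) (rule exI)
qed

section \<open>Formulas for the lattice operations\<close>

text \<open>Collecting the parts assigned to \<open>S\<close> into \<open>y\<close> leaves
  \<open>x - y\<close> for \<open>T\<close>. A single term corresponds to \<open>y = x\<close> or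
  \<open>y = 0\<close>.\<close>

lemma split_values_pair:
  assumes "is_operator S" "is_operator T" "0 \<le> x"
  shows "{u. split_value {S, T} x u} = {S y + T (x - y) | y. y \<in> {0..x}}"
proof (intro equalityI subsetI)
  fix u assume "u \<in> {u. split_value {S, T} x u}"
  then have "split_value {S, T} x u" by simp
  then have "\<exists>y. 0 \<le> y \<and> y \<le> x \<and> u = S y + T (x - y)"
  proof (induction rule: split_value.induct)
    case (base R x)
    then show ?case
      using assms(1,2)
      by (auto simp: operator_0 intro: exI[of _ x] exI[of _ 0])
  next
    case (add x u x' u')
    then obtain y y' where "0 \<le> y" "y \<le> x" "u = S y + T (x - y)" "0 \<le> y'" "y' \<le> x'" "u' = S y' + T (x' - y')"
      by blast
    then show ?case
      using assms(1,2)
      by (intro exI[of _ "y + y'"]) (simp add: operator_add operator_diff add_mono)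
  qed
  then show "u \<in> {S y + T (x - y) | y. y \<in> {0..x}}" by auto
next
  fix u assume "u \<in> {S y + T (x - y) | y. y \<in> {0..x}}"
  then obtain y where y: "0 \<le> y" "y \<le> x" "u = S y + T (x - y)" by auto
  then have "split_value {S, T} (y + (x - y)) (S y + T (x - y))"
    by (intro split_value.add split_value.base) auto
  then show "u \<in> {u. split_value {S, T} x u}" using y by simp
qed

lemma bdd_above_split_pair:
  assumes "S \<in> Lb" "T \<in> Lb"
  shows "bdd_above {S y + T (x - y) | y. y \<in> {0..x}}"
proof -
  obtain c d where S: "\<And>y. 0 \<le> y \<Longrightarrow> y \<le> x \<Longrightarrow> S y \<le> d"
    using Lb_boundedE[OF assms(1), of 0 x] by metis
  obtain c' d' where T: "\<And>y. 0 \<le> y \<Longrightarrow> y \<le> x \<Longrightarrow> T y \<le> d'"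
    using Lb_boundedE[OF assms(2), of 0 x] by metis
  show ?thesis
    by (rule bdd_aboveI[of _ "d + d'"]) (auto intro!: add_mono S T)
qed

lemma ex_is_sup_pair:
  assumes "S \<in> Lb" "T \<in> Lb"
  shows "\<exists>F. is_sup Lb op_le {S, T} F \<and> (\<forall>x\<ge>0. F x = Sup {S y + T (x - y) | y. y \<in> {0..x}})"
  using ex_is_sup[of "{S, T}"] assms bdd_above_split_pair[OF assms] split_values_pair[of S T]
  by (simp add: is_operator_if_Lb)

lemma join_on_Lb:
  assumes "S \<in> Lb" "T \<in> Lb"
  shows is_sup_join_on_Lb: "is_sup Lb op_le {S, T} (join_on Lb op_le S T)"
    and join_on_Lb_apply: "\<And>x. 0 \<le> x \<Longrightarrow> join_on Lb op_le S T x = Sup {S y + T (x - y) | y. y \<in> {0..x}}"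
proof -
  obtain F where F: "is_sup Lb op_le {S, T} F"
    "\<And>x. 0 \<le> x \<Longrightarrow> F x = Sup {S y + T (x - y) | y. y \<in> {0..x}}"
    using ex_is_sup_pair[OF assms] by blast
  have join: "join_on Lb op_le S T = F"
    by (rule Lb.join_on_eq) (rule F(1))
  show "is_sup Lb op_le {S, T} (join_on Lb op_le S T)"
    unfolding join by (rule F(1))
  show "join_on Lb op_le S T x = Sup {S y + T (x - y) | y. y \<in> {0..x}}" if "0 \<le> x" for x
    unfolding join using that by (rule F(2))
qed

lemma op_le_uminus_iff:
  "S \<in> Lb \<Longrightarrow> T \<in> Lb \<Longrightarrow> op_le (- S) T \<longleftrightarrow> op_le (- T) S"
  by (simp add: op_le_iff Lb_uminus minus_le_iff)

text \<open>Negation reverses \<open>op_le\<close>, so infima come from joins by duality.\<close>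

lemma is_inf_pair:
  assumes "S \<in> Lb" "T \<in> Lb"
  shows "is_inf Lb op_le {S, T} (- join_on Lb op_le (- S) (- T))"
proof -
  let ?J = "join_on Lb op_le (- S) (- T)"
  have J: "is_sup Lb op_le {- S, - T} ?J"
    using assms by (intro is_sup_join_on_Lb Lb_uminus)
  then have Lb: "?J \<in> Lb" by (simp add: is_sup_def)
  have "op_le (- ?J) R" if "R \<in> {S, T}" for R
    using J Lb assms that op_le_uminus_iff[of R ?J] by (auto simp: is_sup_def)
  moreover have "op_le U (- ?J)" if U: "U \<in> Lb" "\<forall>R\<in>{S, T}. op_le U R" for U
  proof -
    have "op_le (- R) (- U)" if "R \<in> {S, T}" for R
      using U assms that by (auto simp: op_le_iff Lb_uminus)
    then have "op_le ?J (- U)"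
      using J Lb_uminus[OF U(1)] by (simp add: is_sup_def)
    then show ?thesis
      using Lb U by (simp add: op_le_iff Lb_uminus le_minus_iff)
  qed
  ultimately show ?thesis
    using Lb by (simp add: is_inf_def Lb_uminus)
qed

lemma uminus_image_split_pair:
  "uminus ` {S y + T (x - y) | y. y \<in> {0..x}} = {(- S) y + (- T) (x - y) | y. y \<in> {0..x :: 'x}}"
  for S T :: "'x \<Rightarrow> 'y"
  by (simp only: Setcompr_eq_image image_image) simp

lemma meet_on_Lb_apply:
  assumes "S \<in> Lb" "T \<in> Lb" "0 \<le> x"
  shows "bdd_below {S y + T (x - y) | y. y \<in> {0..x}}"
    and "meet_on Lb op_le S T x = Inf {S y + T (x - y) | y. y \<in> {0..x}}"
proof -
  let ?D = "{S y + T (x - y) | y. y \<in> {0..x}}"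
  have bdd: "bdd_above (uminus ` ?D)"
    unfolding uminus_image_split_pair using assms by (intro bdd_above_split_pair Lb_uminus)
  then show "bdd_below ?D"
    by (simp only: bdd_above_uminus)
  have "?D \<noteq> {}" using assms(3) by auto
  then have "Inf ?D = - Sup (uminus ` ?D)"
    using bdd by (rule Inf_eq_uminus_Sup)
  also have "\<dots> = - join_on Lb op_le (- S) (- T) x"
    unfolding uminus_image_split_pair
    using assms by (simp only: join_on_Lb_apply Lb_uminus)
  also have "\<dots> = meet_on Lb op_le S T x"
    using Lb.meet_on_eq[OF is_inf_pair[OF assms(1,2)]] by simp
  finally show "meet_on Lb op_le S T x = Inf ?D" by simp
qed

lemma pos_part_apply:
  assumes "S \<in> Lb" "0 \<le> x"
  shows "bdd_above {S y | y. y \<in> {0..x}}"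
    and "join_on Lb op_le S 0 x = Sup {S y | y. y \<in> {0..x}}"
  using bdd_above_split_pair[OF assms(1) Lb_zero, of x] join_on_Lb_apply[OF assms(1) Lb_zero assms(2)]
  by simp_all

lemma neg_part_apply:
  assumes "S \<in> Lb" "0 \<le> x"
  shows "bdd_below {S y | y. y \<in> {0..x}}"
    and "join_on Lb op_le (- S) 0 x = - Inf {S y | y. y \<in> {0..x}}"
proof -
  let ?D = "{S y | y. y \<in> {0..x}}"
  have image: "uminus ` ?D = {(- S) y | y. y \<in> {0..x}}"
    by (simp only: Setcompr_eq_image image_image) simp
  have bdd: "bdd_above (uminus ` ?D)"
    unfolding image using assms by (intro pos_part_apply Lb_uminus)
  then show "bdd_below ?D"
    by (simp only: bdd_above_uminus)
  have "?D \<noteq> {}" using assms(2) by auto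
  then have "Inf ?D = - Sup (uminus ` ?D)"
    using bdd by (rule Inf_eq_uminus_Sup)
  then show "join_on Lb op_le (- S) 0 x = - Inf ?D"
    unfolding image using assms by (simp only: pos_part_apply Lb_uminus minus_minus)
qed

text \<open>The substitution \<open>z = 2 y - x\<close> maps \<open>[0, x]\<close> onto \<open>[-x, x]\<close>.\<close>

lemma abs_apply:
  assumes "S \<in> Lb" "0 \<le> x"
  shows "bdd_above {S y | y. y \<in> {- x..x}}"
    and "join_on Lb op_le S (- S) x = Sup {S y | y. y \<in> {- x..x}}"
proof -
  have S: "is_operator S" using assms(1) by (rule is_operator_if_Lb)
  let ?h = "sX ((1 / 2) *\<^sub>R 1)"
  have eq: "{S y + (- S) (x - y) | y. y \<in> {0..x}} = {S y | y. y \<in> {- x..x}}"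
  proof (intro equalityI subsetI)
    fix u assume "u \<in> {S y + (- S) (x - y) | y. y \<in> {0..x}}"
    then obtain y where y: "0 \<le> y" "y \<le> x" "u = S y - S (x - y)" by auto
    have "- x \<le> y - (x - y)"
      using y by (simp add: algebra_simps)
    moreover have "y - (x - y) \<le> x"
      using add_mono[OF y(2) y(2)] by (simp add: algebra_simps)
    ultimately have "y - (x - y) \<in> {- x..x}"
      by (simp only: atLeastAtMost_iff)
    moreover have "u = S (y - (x - y))"
      using y(3) operator_diff[OF S, of y "x - y"] by simp
    ultimately show "u \<in> {S y | y. y \<in> {- x..x}}"
      by blast
  next
    fix u assume "u \<in> {S y | y. y \<in> {- x..x}}"
    then obtain z where z: "- x \<le> z" "z \<le> x" "u = S z" by auto
    have h: "0 \<le> (1 / 2) *\<^sub>R (1 :: 'l)" by (rule scaleR_one_nonneg) simp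
    \<comment> \<open>The preimage of \<open>z\<close> under the substitution; halving is available
      because the scalars contain the reals.\<close>
    define y where "y = ?h (x + z)"
    have "0 \<le> x + z"
      using z(1) by (metis add_left_mono add.right_inverse)
    then have "0 \<le> y"
      unfolding y_def using h by (intro X.smul_nonneg)
    have xy: "x - y = ?h (x - z)"
    proof -
      have "x - y = (?h x + ?h x) - ?h (x + z)"
        by (simp only: X.double_half_smul y_def)
      then show ?thesis by (simp add: X.smul_add_right X.smul_diff)
    qed
    moreover have "0 \<le> ?h (x - z)"
      using z(2) h by (intro X.smul_nonneg) simp_all
    ultimately have "y \<le> x" by (metis diff_ge_0_iff_ge)
    have "y - (x - y) = ?h z + ?h z"
      unfolding xy by (simp add: y_def X.smul_add_right X.smul_diff)
    then have "z = y - (x - y)" by (simp only: X.double_half_smul)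
    then have "u = S y + (- S) (x - y)"
      using z(3) operator_diff[OF S, of y "x - y"] by simp
    then show "u \<in> {S y + (- S) (x - y) | y. y \<in> {0..x}}"
      using \<open>0 \<le> y\<close> \<open>y \<le> x\<close> by auto
  qed
  show "bdd_above {S y | y. y \<in> {- x..x}}"
    using bdd_above_split_pair[OF assms(1) Lb_uminus[OF assms(1)], of x] by (simp only: eq)
  show "join_on Lb op_le S (- S) x = Sup {S y | y. y \<in> {- x..x}}"
    using join_on_Lb_apply[OF assms(1) Lb_uminus[OF assms(1)] assms(2)] by (simp only: eq)
qed

section \<open>Regular operators and increasing nets\<close>

text \<open>The join of \<open>T\<close> and 0 lies above both, so it and its difference with
  \<open>T\<close> are positive operators that represent \<open>T\<close>.\<close>

lemma Lb_eq_regular: "Lb = regular_operators sX sY"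
proof (intro equalityI subsetI)
  fix T assume T: "T \<in> Lb"
  let ?P = "join_on Lb op_le T 0"
  have "is_sup Lb op_le {T, 0} ?P"
    using T Lb_zero by (rule is_sup_join_on_Lb)
  then have "positive_operator sX sY ?P" "positive_operator sX sY (?P - T)"
    by (auto simp: is_sup_def operator_le_def)
  then show "T \<in> regular_operators sX sY"
    unfolding regular_operators_def by (intro CollectI exI[of _ ?P] exI[of _ "?P - T"]) simp
next
  fix T assume "T \<in> regular_operators sX sY"
  then show "T \<in> Lb"
    by (auto simp: regular_operators_def intro: Lb_diff Lb_if_positive)
qed

lemma vector_lattice_module_Lb: "vector_lattice_module Lb (operator_smul sY) op_le"
  by unfold_locales (rule exI, erule (1) is_sup_join_on_Lb is_inf_pair)+

text \<open>Pointwise suprema pass to operators because the order is tested on the cone. Conversely,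
  uniqueness identifies \<open>T\<close> with the supremum of split values, and directedness reduces
  these to the values \<open>t i x\<close>.\<close>

lemma net_is_sup_iff:
  assumes net: "increasing_net I r Lb op_le t" and T: "T \<in> Lb"
  shows "is_sup Lb op_le (t ` I) T \<longleftrightarrow> (\<forall>x\<ge>0. is_sup UNIV (\<le>) ((\<lambda>i. t i x) ` I) (T x))"
proof
  have t: "t i \<in> Lb" if "i \<in> I" for i
    using net that by (auto simp: increasing_net_def)
  assume "\<forall>x\<ge>0. is_sup UNIV (\<le>) ((\<lambda>i. t i x) ` I) (T x)"
  then show "is_sup Lb op_le (t ` I) T"
    using T t by (auto simp: is_sup_def op_le_iff)
next
  have t: "t i \<in> Lb" if "i \<in> I" for i
    using net that by (auto simp: increasing_net_def)
  have dir: "\<exists>k\<in>I. op_le (t i) (t k) \<and> op_le (t j) (t k)" if ij: "i \<in> I" "j \<in> I" for i j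
  proof -
    have "\<forall>i\<in>I. \<forall>j\<in>I. \<exists>k\<in>I. r i k \<and> r j k"
      using net unfolding increasing_net_def directed_preorder_def by (elim conjE)
    with ij obtain k where k: "k \<in> I" "r i k" "r j k" by blast
    have "op_le (t i) (t k) \<and> op_le (t j) (t k)"
      using net ij k unfolding increasing_net_def by (elim conjE) simp
    with k(1) show ?thesis by (rule bexI[rotated])
  qed
  have ne: "I \<noteq> {}"
    using net by (auto simp: increasing_net_def directed_preorder_def)
  assume T_sup: "is_sup Lb op_le (t ` I) T"
  obtain F where "is_sup Lb op_le (t ` I) F" and F: "\<And>x. 0 \<le> x \<Longrightarrow> F x = Sup {u. split_value (t ` I) x u}"
  proof -
    have "t ` I \<noteq> {}" "t ` I \<subseteq> Lb" "\<forall>R\<in>t ` I. op_le R T"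
      using T_sup ne t by (auto simp: is_sup_def)
    from ex_is_sup_if_bounded[OF this(1,2) T this(3)] that show ?thesis by blast
  qed
  then have "T = F"
    using T_sup Lb.is_sup_unique by blast
  \<comment> \<open>Two indices have a common later one that dominates both summands, and additivity
    of that single operator reassembles them.\<close>
  have dom: "\<exists>i\<in>I. u \<le> t i x" if "split_value (t ` I) x u" for x u
    using that
  proof (induction rule: split_value.induct)
    case (base R x)
    then show ?case by auto
  next
    case (add x u y v)
    then obtain i j where ij: "i \<in> I" "u \<le> t i x" "j \<in> I" "v \<le> t j y" by blast
    obtain k where k: "k \<in> I" "op_le (t i) (t k)" "op_le (t j) (t k)"
      using dir[OF ij(1,3)] by blast
    have "u \<le> t k x" "v \<le> t k y"
      using ij k t add.hyps[THEN split_value_nonneg] by (auto simp: op_le_iff intro: order_trans)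
    then show ?case
      using k(1) t[OF k(1)] by (intro bexI[of _ k]) (auto simp: operator_add is_operator_if_Lb add_mono)
  qed
  show "\<forall>x\<ge>0. is_sup UNIV (\<le>) ((\<lambda>i. t i x) ` I) (T x)"
  proof (intro allI impI)
    fix x :: 'x assume x: "0 \<le> x"
    have "T x \<le> c" if c: "\<And>i. i \<in> I \<Longrightarrow> t i x \<le> c" for c
      unfolding \<open>T = F\<close> F[OF x]
    proof (rule cSup_least)
      show "{u. split_value (t ` I) x u} \<noteq> {}"
        using ne split_value.base[of _ "t ` I", OF _ x] by blast
      fix u assume "u \<in> {u. split_value (t ` I) x u}"
      then show "u \<le> c" using dom c by (blast intro: order_trans)
    qed
    moreover have "t i x \<le> T x" if "i \<in> I" for i
      using T_sup T t that x by (auto simp: is_sup_def op_le_iff)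
    ultimately show "is_sup UNIV (\<le>) ((\<lambda>i. t i x) ` I) (T x)"
      by (auto simp: is_sup_def)
  qed
qed

end

text \<open>Each \<open>Sup\<close> and \<open>Inf\<close> is accompanied by a bound for its set,
  since only for nonempty bounded sets is it a true supremum or infimum. Positive part, negative
  part and modulus are written as joins.\<close>

theorem theorem5p1:
  fixes sX :: "'l::{unital_f_algebra, conditionally_complete_lattice} \<Rightarrow> 'x::ordered_ab_group_add \<Rightarrow> 'x"
    and sY :: "'l \<Rightarrow> 'y::{ordered_ab_group_add, conditionally_complete_lattice} \<Rightarrow> 'y"
  defines "Lb \<equiv> order_bounded_operators sX sY"
    and "le \<equiv> operator_le sX sY"
  assumes X: "po_module UNIV sX (\<le>)"
    and X_directed: "\<forall>x y::'x. \<exists>z. x \<le> z \<and> y \<le> z"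
    and X_RDP: "\<forall>x y::'x. 0 \<le> x \<longrightarrow> 0 \<le> y \<longrightarrow> {0..x + y} = {0..x} + {0..y}"
    and Y: "vector_lattice_module UNIV sY (\<le>)"
    and "sequentially_P_archimedean sY \<or> (UNIV :: 'l set) = ideal_of_one"
  shows "vector_lattice_module Lb (operator_smul sY :: 'l \<Rightarrow> ('x \<Rightarrow> 'y) \<Rightarrow> 'x \<Rightarrow> 'y) le
    \<and> Lb = regular_operators sX sY
    \<and> dedekind_complete_on Lb le
    \<and> (\<forall>S\<in>Lb. \<forall>T\<in>Lb. \<forall>x\<ge>0.
        bdd_above {S y + T (x - y) | y. y \<in> {0..x}}
        \<and> join_on Lb le S T x = Sup {S y + T (x - y) | y. y \<in> {0..x}}
        \<and> bdd_below {S y + T (x - y) | y. y \<in> {0..x}}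
        \<and> meet_on Lb le S T x = Inf {S y + T (x - y) | y. y \<in> {0..x}}
        \<and> bdd_above {S y | y. y \<in> {0..x}}
        \<and> join_on Lb le S 0 x = Sup {S y | y. y \<in> {0..x}}
        \<and> bdd_below {S y | y. y \<in> {0..x}}
        \<and> join_on Lb le (- S) 0 x = - Inf {S y | y. y \<in> {0..x}}
        \<and> bdd_above {S y | y. y \<in> {- x..x}}
        \<and> join_on Lb le S (- S) x = Sup {S y | y. y \<in> {- x..x}})
    \<and> (\<forall>(I :: 'i set) r (t :: 'i \<Rightarrow> 'x \<Rightarrow> 'y). \<forall>T\<in>Lb. increasing_net I r Lb le t \<longrightarrow>
        (is_sup Lb le (t ` I) T \<longleftrightarrow>
          (\<forall>x\<ge>0. is_sup UNIV (\<le>) ((\<lambda>i. t i x) ` I) (T x))))"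
proof -
  interpret ops: operator_setting sX sY
  proof (intro operator_setting.intro full_po_module.intro operator_setting_axioms.intro)
    show "po_module UNIV sX (\<le>)" by (rule X)
    show "po_module UNIV sY (\<le>)" using Y by (rule vector_lattice_module.axioms)
  qed (use X_directed X_RDP in blast)+
  show ?thesis
  proof (intro conjI ballI allI impI)
    show "vector_lattice_module Lb (operator_smul sY) le"
      "Lb = regular_operators sX sY" "dedekind_complete_on Lb le"
      unfolding Lb_def le_def
      by (rule ops.vector_lattice_module_Lb ops.Lb_eq_regular ops.dedekind_complete_Lb)+
  next
    fix S T x
    assume S: "S \<in> Lb" and T: "T \<in> Lb" and x: "0 \<le> (x :: 'x)"
    note ST = S[unfolded Lb_def] T[unfolded Lb_def] and Sx = S[unfolded Lb_def] x
    show "bdd_above {S y + T (x - y) | y. y \<in> {0..x}}"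
      using ST by (rule ops.bdd_above_split_pair)
    show "join_on Lb le S T x = Sup {S y + T (x - y) | y. y \<in> {0..x}}"
      unfolding Lb_def le_def using ST x by (rule ops.join_on_Lb_apply)
    show "bdd_below {S y + T (x - y) | y. y \<in> {0..x}}"
      using ST x by (rule ops.meet_on_Lb_apply)
    show "meet_on Lb le S T x = Inf {S y + T (x - y) | y. y \<in> {0..x}}"
      unfolding Lb_def le_def using ST x by (rule ops.meet_on_Lb_apply)
    show "bdd_above {S y | y. y \<in> {0..x}}"
      using Sx by (rule ops.pos_part_apply)
    show "join_on Lb le S 0 x = Sup {S y | y. y \<in> {0..x}}"
      unfolding Lb_def le_def using Sx by (rule ops.pos_part_apply)
    show "bdd_below {S y | y. y \<in> {0..x}}"
      using Sx by (rule ops.neg_part_apply)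
    show "join_on Lb le (- S) 0 x = - Inf {S y | y. y \<in> {0..x}}"
      unfolding Lb_def le_def using Sx by (rule ops.neg_part_apply)
    show "bdd_above {S y | y. y \<in> {- x..x}}"
      using Sx by (rule ops.abs_apply)
    show "join_on Lb le S (- S) x = Sup {S y | y. y \<in> {- x..x}}"
      unfolding Lb_def le_def using Sx by (rule ops.abs_apply)
  next
    fix I :: "'i set" and r t T
    assume "T \<in> Lb" "increasing_net I r Lb le t"
    then show "is_sup Lb le (t ` I) T \<longleftrightarrow>
        (\<forall>x\<ge>0. is_sup UNIV (\<le>) ((\<lambda>i. t i x) ` I) (T x))"
      unfolding Lb_def le_def by (intro ops.net_is_sup_iff)
  qed
qed

end
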